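(* Let $\mathcal I\subset\mathbb Z^d$ be a finite multi-index set with Fourier weights $\hat{\boldsymbol W}=\operatorname{diag}(\hat w_{\boldsymbol n})_{\boldsymbol n\in\mathcal I}$, and let $\mathcal X\subset\mathbb T^d$ be a finite set of nodes with weights $\boldsymbol W=\operatorname{diag}(w_{\boldsymbol x})_{\boldsymbol x\in\mathcal X}$ such that $(\mathcal X,\boldsymbol W)$ is a quadrature rule which is exact for all $\mathrm e^{2\pi\mathrm i\boldsymbol n\cdot(\,\cdot\,)}$ with $\boldsymbol n\in\mathcal D(\mathcal I)=\{\boldsymbol n_1-\boldsymbol n_2:\boldsymbol n_1,\boldsymbol n_2\in\mathcal I\}$. Let $\boldsymbol F=(\mathrm e^{2\pi\mathrm i\boldsymbol n\cdot\boldsymbol x})_{\boldsymbol x\in\mathcal X,\boldsymbol n\in\mathcal I}$. Then, for a fixed regularization parameter $\lambda>0$ and given data $\boldsymbol f\in\mathbb C^{|\mathcal X|}$, both the ordinary cross-validation score $P(\lambda)$ and the generalized cross-validation score $V(\lambda)$ can be computed with the same complexity as multiplying a vector with $\boldsymbol F$ or $\boldsymbol F^{\mathsf H}$: if matrix-vector products with $\boldsymbol F$ and with $\boldsymbol F^{\mathsf H}$ can each be computed at cost at most $C$, then $P(\lambda)$ and $V(\lambda)$ can be computed at cost $\mathcal O(C)$, with an absolute implied constant. This is achieved by the following algorithm: compute $\tilde{\boldsymbol f}=\boldsymbol H\boldsymbol f$; compute the diagonal entries $h_{\boldsymbol x,\boldsymbol x}$ of $\boldsymbol H$ and their mean $h$;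 then evaluate $P(\lambda)$ and $V(\lambda)$ as $\sum_{\boldsymbol x}|\tilde f_{\boldsymbol x}-f_{\boldsymbol x}|^2/(1-h_{\boldsymbol x,\boldsymbol x})^2$ and $\sum_{\boldsymbol x}|\tilde f_{\boldsymbol x}-f_{\boldsymbol x}|^2/(1-h)^2$.
   Context: $\mathbb T^d=\mathbb R^d/\mathbb Z^d$ carries Lebesgue measure of total mass $1$. Exactness of $(\mathcal X,\boldsymbol W)$ for a function $g$ means $\sum_{\boldsymbol x\in\mathcal X}w_{\boldsymbol x}g(\boldsymbol x)=\int_{\mathbb T^d}g(\boldsymbol x)\,\mathrm d\boldsymbol x$. The weights $w_{\boldsymbol x}$, $\hat w_{\boldsymbol n}$ are strictly positive reals. $^{\mathsf H}$ denotes conjugate transpose. Cost is the number of exact arithmetic operations on complex numbers, including complex conjugation, plus the reading of input entries and writing of output entries (so $C\ge|\mathcal X|+|\mathcal I|$). The inputs are $\mathcal X,\mathcal I,\boldsymbol W,\hat{\boldsymbol W},\boldsymbol f,\lambda$. Hat matrix: $\boldsymbol H=\boldsymbol F(\boldsymbol F^{\mathsf H}\boldsymbol W\boldsymbol F+\lambda\hat{\boldsymbol W})^{-1}\boldsymbol F^{\mathsf H}\boldsymbol W$, with diagonal entries $h_{\boldsymbol x,\boldsymbol x}$ and $h=\frac1{|\mathcal X|}\sum_{\boldsymbol x\in\mathcal X}h_{\boldsymbol x,\boldsymbol x}$. Ordinary cross-validation score: $P(\lambda)=\sum_{\boldsymbol x\in\mathcal X}|[\boldsymbol F\tilde{\boldsymbol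 f}_{(\boldsymbol x)}]_{\boldsymbol x}-f_{\boldsymbol x}|^2$, where $\tilde{\boldsymbol f}_{(\boldsymbol x)}=(\boldsymbol F_{(\boldsymbol x)}^{\mathsf H}\boldsymbol W_{(\boldsymbol x)}\boldsymbol F_{(\boldsymbol x)}+\lambda\hat{\boldsymbol W})^{-1}\boldsymbol F_{(\boldsymbol x)}^{\mathsf H}\boldsymbol W_{(\boldsymbol x)}\boldsymbol f_{(\boldsymbol x)}$ and the subscript $(\boldsymbol x)$ on $\boldsymbol F$, $\boldsymbol W$, $\boldsymbol f$ means that the row (for $\boldsymbol W$: row and column; for $\boldsymbol f$: entry) belonging to node $\boldsymbol x$ is removed. Generalized cross-validation score: $V(\lambda)=\sum_{\boldsymbol x\in\mathcal X}\frac{|[\boldsymbol H\boldsymbol f-\boldsymbol f]_{\boldsymbol x}|^2}{(1-h)^2}$. *)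

theory Defs
  imports
    "HOL-Analysis.Analysis"
    "Jordan_Normal_Form.Schur_Decomposition"
    "Jordan_Normal_Form.Gauss_Jordan_Elimination"
begin

(* "$" is the entry of a Jordan_Normal_Form vector from here on *)
unbundle no vec_syntax

section \<open>Quadrature on the torus\<close>

type_synonym node = "nat \<Rightarrow> real"
type_synonym freq = "nat \<Rightarrow> int"

text \<open>The torus of dimension d is represented by its fundamental domain, the cube of
  points with d coordinates in the half-open unit interval (coordinates beyond d are
  \<^term>\<open>undefined\<close>, so that equality of functions is equality of points).  Since d is a
  number and not a type, constants can be quantified uniformly over all dimensions.\<close>

definition torus_measure :: "nat \<Rightarrow> node measure" where
  "torus_measure d = (\<Pi>\<^sub>M k\<in>{..<d}. restrict_space lborel {0..<1})"

definition torus :: "nat \<Rightarrow> node set" where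
  "torus d = ({..<d} \<rightarrow>\<^sub>E {0..<1})"

definition multi_indices :: "nat \<Rightarrow> freq set" where
  "multi_indices d = ({..<d} \<rightarrow>\<^sub>E UNIV)"

definition expo :: "nat \<Rightarrow> freq \<Rightarrow> node \<Rightarrow> complex" where
  "expo d n x = exp (2 * of_real pi * \<i> * of_real (\<Sum>k<d. of_int (n k) * x k))"

definition difference_set :: "nat \<Rightarrow> freq set \<Rightarrow> freq set" where
  "difference_set d I = {\<lambda>k\<in>{..<d}. n1 k - n2 k | n1 n2. n1 \<in> I \<and> n2 \<in> I}"

definition exact_for :: "nat \<Rightarrow> node set \<Rightarrow> (node \<Rightarrow> real) \<Rightarrow> (node \<Rightarrow> complex) \<Rightarrow> bool" where
  "exact_for d X w g \<longleftrightarrow>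
     (\<Sum>x\<in>X. of_real (w x) * g x) = (LINT x|torus_measure d. g x)"

section \<open>Matrices and cross-validation scores\<close>

text \<open>The finite sets of nodes and of multi-indices are given by duplicate-free lists,
  whose order fixes the order of the rows and columns of the matrices.\<close>

definition fourier_mat :: "nat \<Rightarrow> node list \<Rightarrow> freq list \<Rightarrow> complex mat" where
  "fourier_mat d xs ns =
     Matrix.mat (length xs) (length ns) (\<lambda>(i, j). expo d (ns ! j) (xs ! i))"

definition weight_mat :: "('a \<Rightarrow> real) \<Rightarrow> 'a list \<Rightarrow> complex mat" where
  "weight_mat w as = mat_diag (length as) (\<lambda>i. of_real (w (as ! i)))"

text \<open>For singular matrices this value is arbitrary; every matrix inverted below is
  positive definite in the situation of the theorem.\<close>

definition inv_mat :: "complex mat \<Rightarrow> complex mat" where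
  "inv_mat A = the (mat_inverse A)"

definition regularized_solve :: "complex mat \<Rightarrow> complex mat \<Rightarrow> complex mat \<Rightarrow> real \<Rightarrow> complex mat" where
  "regularized_solve F W What lam =
     inv_mat (mat_adjoint F * W * F + complex_of_real lam \<cdot>\<^sub>m What) * mat_adjoint F * W"

definition hat_mat ::
  "nat \<Rightarrow> node list \<Rightarrow> freq list \<Rightarrow> (node \<Rightarrow> real) \<Rightarrow> (freq \<Rightarrow> real) \<Rightarrow> real \<Rightarrow> complex mat" where
  "hat_mat d xs ns w what lam =
     fourier_mat d xs ns *
     regularized_solve (fourier_mat d xs ns) (weight_mat w xs) (weight_mat what ns) lam"

definition hat_mean ::
  "nat \<Rightarrow> node list \<Rightarrow> freq list \<Rightarrow> (node \<Rightarrow> real) \<Rightarrow> (freq \<Rightarrow> real) \<Rightarrow> real \<Rightarrow> complex" where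
  "hat_mean d xs ns w what lam =
     (\<Sum>i<length xs. hat_mat d xs ns w what lam $$ (i, i)) / of_nat (length xs)"

text \<open>Removal of a row of a matrix and of an entry of a vector; row and column are removed
  simultaneously by the library function \<^const>\<open>mat_delete\<close>.\<close>

definition delete_row :: "complex mat \<Rightarrow> nat \<Rightarrow> complex mat" where
  "delete_row A i =
     Matrix.mat (dim_row A - 1) (dim_col A) (\<lambda>(k, j). A $$ (insert_index i k, j))"

definition delete_entry :: "complex Matrix.vec \<Rightarrow> nat \<Rightarrow> complex Matrix.vec" where
  "delete_entry v i = Matrix.vec (dim_vec v - 1) (\<lambda>k. v $ insert_index i k)"

definition leave_one_out ::
  "nat \<Rightarrow> node list \<Rightarrow> freq list \<Rightarrow> (node \<Rightarrow> real) \<Rightarrow> (freq \<Rightarrow> real) \<Rightarrow> complex Matrix.vec \<Rightarrow> real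
    \<Rightarrow> nat \<Rightarrow> complex Matrix.vec" where
  "leave_one_out d xs ns w what f lam i =
     regularized_solve (delete_row (fourier_mat d xs ns) i) (mat_delete (weight_mat w xs) i i)
       (weight_mat what ns) lam *\<^sub>v delete_entry f i"

definition ocv_score ::
  "nat \<Rightarrow> node list \<Rightarrow> freq list \<Rightarrow> (node \<Rightarrow> real) \<Rightarrow> (freq \<Rightarrow> real) \<Rightarrow> complex Matrix.vec \<Rightarrow> real
    \<Rightarrow> complex" where
  "ocv_score d xs ns w what f lam =
     (\<Sum>i<length xs.
        of_real ((cmod ((fourier_mat d xs ns *\<^sub>v leave_one_out d xs ns w what f lam i) $ i - f $ i))\<^sup>2))"

definition gcv_score ::
  "nat \<Rightarrow> node list \<Rightarrow> freq list \<Rightarrow> (node \<Rightarrow> real) \<Rightarrow> (freq \<Rightarrow> real) \<Rightarrow> complex Matrix.vec \<Rightarrow> real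
    \<Rightarrow> complex" where
  "gcv_score d xs ns w what f lam =
     (\<Sum>i<length xs.
        of_real ((cmod ((hat_mat d xs ns w what lam *\<^sub>v f - f) $ i))\<^sup>2)
          / (1 - hat_mean d xs ns w what lam)\<^sup>2)"

section \<open>Arithmetic programs and their cost\<close>

text \<open>Straight-line programs over the complex numbers.  The first argument of an
  arithmetic instruction is the target register.  \<open>Input r i\<close> reads the i-th input entry
  into register r, \<open>Output r\<close> appends the content of r to the output.  \<open>Call k a l b\<close> runs
  subroutine k on the l registers from a on and stores its output in the registers from b on.\<close>

datatype instr =
    Const nat complex
  | Input nat nat
  | Add nat nat nat
  | Sub nat nat nat
  | Mul nat nat nat
  | Div nat nat nat
  | Conj nat nat
  | Output nat
  | Call nat nat nat nat

type_synonym prog = "instr list"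
type_synonym memory = "nat \<Rightarrow> complex"
type_synonym state = "memory \<times> complex list"

definition store :: "memory \<Rightarrow> nat \<Rightarrow> complex list \<Rightarrow> memory" where
  "store s b ys = (\<lambda>r. if b \<le> r \<and> r < b + length ys then ys ! (r - b) else s r)"

text \<open>The result \<^const>\<open>None\<close> is failure: division by zero, reading a missing input entry, or a
  failing or missing subroutine.\<close>

fun step :: "(nat \<Rightarrow> complex list \<Rightarrow> complex list option) \<Rightarrow> complex list \<Rightarrow> instr \<Rightarrow> state
    \<Rightarrow> state option" where
  "step sub inp (Const r c) (s, out) = Some (s(r := c), out)"
| "step sub inp (Input r i) (s, out) =
     (if i < length inp then Some (s(r := inp ! i), out) else None)"
| "step sub inp (Add r a b) (s, out) = Some (s(r := s a + s b), out)"
| "step sub inp (Sub r a b) (s, out) = Some (s(r := s a - s b), out)"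
| "step sub inp (Mul r a b) (s, out) = Some (s(r := s a * s b), out)"
| "step sub inp (Div r a b) (s, out) =
     (if s b \<noteq> 0 then Some (s(r := s a / s b), out) else None)"
| "step sub inp (Conj r a) (s, out) = Some (s(r := cnj (s a)), out)"
| "step sub inp (Output r) (s, out) = Some (s, out @ [s r])"
| "step sub inp (Call k a l b) (s, out) =
     (case sub k (map s [a..<a + l]) of None \<Rightarrow> None | Some ys \<Rightarrow> Some (store s b ys, out))"

fun run :: "(nat \<Rightarrow> complex list \<Rightarrow> complex list option) \<Rightarrow> complex list \<Rightarrow> prog \<Rightarrow> state
    \<Rightarrow> state option" where
  "run sub inp [] st = Some st"
| "run sub inp (c # p) st =
     (case step sub inp c st of None \<Rightarrow> None | Some st' \<Rightarrow> run sub inp p st')"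

definition init_state :: state where
  "init_state = (\<lambda>_. 0, [])"

definition eval_prog :: "(nat \<Rightarrow> complex list \<Rightarrow> complex list option) \<Rightarrow> prog \<Rightarrow> complex list
    \<Rightarrow> complex list option" where
  "eval_prog sub p inp = map_option snd (run sub inp p init_state)"

text \<open>Only programs without calls can serve as subroutines.\<close>

definition no_subs :: "nat \<Rightarrow> complex list \<Rightarrow> complex list option" where
  "no_subs = (\<lambda>_ _. None)"

definition subs_of :: "prog list \<Rightarrow> nat \<Rightarrow> complex list \<Rightarrow> complex list option" where
  "subs_of ps k inp = (if k < length ps then eval_prog no_subs (ps ! k) inp else None)"

text \<open>Each arithmetic operation, each reading of an input entry and each writing of an output
  entry costs 1.  Literal constants are neither and cost nothing.  A call costs as
  much as the called program, given by the first argument.\<close>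

fun instr_cost :: "(nat \<Rightarrow> nat) \<Rightarrow> instr \<Rightarrow> nat" where
  "instr_cost c (Const r z) = 0"
| "instr_cost c (Call k a l b) = c k"
| "instr_cost c _ = 1"

definition cost_with :: "(nat \<Rightarrow> nat) \<Rightarrow> prog \<Rightarrow> nat" where
  "cost_with c p = (\<Sum>i\<leftarrow>p. instr_cost c i)"

definition cost :: "prog list \<Rightarrow> prog \<Rightarrow> nat" where
  "cost ps p = cost_with (\<lambda>k. if k < length ps then cost_with (\<lambda>_. 0) (ps ! k) else 0) p"

text \<open>A program that multiplies with A.  It may depend on A, in particular use constants
  (such as roots of unity) that depend on the nodes and frequencies.\<close>

definition multiplies_with :: "prog \<Rightarrow> complex mat \<Rightarrow> bool" where
  "multiplies_with p A \<longleftrightarrow>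
     (\<forall>v \<in> carrier_vec (dim_col A).
        eval_prog no_subs p (list_of_vec v) = Some (list_of_vec (A *\<^sub>v v)))"

text \<open>The nodes and multi-indices themselves enter a program that
  computes the scores only through the subroutines for the matrix-vector products.\<close>

definition score_input :: "node list \<Rightarrow> freq list \<Rightarrow> (node \<Rightarrow> real) \<Rightarrow> (freq \<Rightarrow> real)
    \<Rightarrow> complex Matrix.vec \<Rightarrow> real \<Rightarrow> complex list" where
  "score_input xs ns w what f lam =
     map (\<lambda>x. of_real (w x)) xs @ map (\<lambda>n. of_real (what n)) ns @ list_of_vec f @ [of_real lam]"

text \<open>The last phase of the algorithm: from arbitrary register contents t (predictions), y (data),
  g (diagonal entries) and h (their mean), all at given addresses, it evaluates and outputs the
  two sums, whatever the inputs and subroutines are.\<close>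

definition evaluates_scores :: "nat \<Rightarrow> nat \<Rightarrow> nat \<Rightarrow> nat \<Rightarrow> nat \<Rightarrow> prog \<Rightarrow> bool" where
  "evaluates_scores m t y g h p \<longleftrightarrow>
     (\<forall>sub inp s out. (\<forall>i<m. s (g + i) \<noteq> 1) \<longrightarrow> s h \<noteq> 1 \<longrightarrow>
        (\<exists>s'. run sub inp p (s, out) = Some (s', out @
           [\<Sum>i<m. of_real ((cmod (s (t + i) - s (y + i)))\<^sup>2) / (1 - s (g + i))\<^sup>2,
            \<Sum>i<m. of_real ((cmod (s (t + i) - s (y + i)))\<^sup>2) / (1 - s h)\<^sup>2])))"

end

theory Submission
  imports Defs
begin

text \<open>Write \<open>u\<close> for the frequency weights and let \<open>A = F\<^sup>H W F + \<lambda> diag u\<close> be the matrix of the normal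
  equations.  Three facts carry the result.

  The design is orthonormal.  The entry of \<open>F\<^sup>H W F\<close> at frequencies \<open>n\<close> and \<open>n'\<close> is the quadrature
  sum of the character with frequency \<open>n' - n\<close>.  By exactness it is the integral of that
  character, which is 1 for \<open>n = n'\<close> and 0 otherwise (\<open>integral_expo\<close>, \<open>fourier_gram\<close>).  So \<open>A\<close> is
  diagonal, and \<open>H f\<close> costs one product with \<open>F\<^sup>H\<close>, one with \<open>F\<close> and \<open>O(|X| + |I|)\<close> further
  operations.  Since the entries of \<open>F\<close> have modulus 1, the diagonal of \<open>H\<close> is
  \<open>w\<^sub>x \<Sum>\<^sub>n 1 / (1 + \<lambda> u\<^sub>n)\<close>: one sum over the frequencies serves all nodes (\<open>hat_diag\<close>).

  The diagonal of \<open>H\<close>, and hence its mean, stays below 1, so the divisions in both scores are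
  legitimate.  The columns of \<open>W\<^sup>1\<^sup>/\<^sup>2 F\<close> are orthonormal; by Bessel's inequality its rows have norm at
  most 1, that is \<open>w\<^sub>x |I| \<le> 1\<close> (\<open>leverage_bound\<close>), and \<open>\<lambda> > 0\<close> makes \<open>h\<^sub>x\<^sub>x\<close> strictly smaller
  than \<open>w\<^sub>x |I|\<close> unless \<open>I\<close> is empty, in which case \<open>H = 0\<close>.

  No leave-one-out system has to be solved.  The fit without node \<open>x\<close> is also the fit to the
  full data in which the entry at \<open>x\<close> is replaced by the prediction of that fit: in the full normal
  equations the node \<open>x\<close> then has residual 0 and contributes nothing (\<open>hat_leave_one_out\<close>).
  Reading off the entry at \<open>x\<close> and using linearity of \<open>H\<close> gives the factor \<open>1 - h\<^sub>x\<^sub>x\<close> between the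
  two residuals (\<open>leave_one_out_residual\<close>).

  The algorithm is then an explicit straight-line program whose phases are verified by
  Hoare-style triples.  It uses the two subroutines once each and \<open>14 |X| + 6 |I| + 6\<close> other
  instructions of cost 1.  A subroutine that outputs \<open>F v\<close> has to write \<open>|X|\<close> entries, one that
  outputs \<open>F\<^sup>H v\<close> has to write \<open>|I|\<close> entries, so \<open>C\<close> bounds both numbers and 28 is an admissible
  constant.\<close>

section \<open>Normal equations of weighted ridge regression\<close>

lemma mat_adjoint_carrier [simp]: "A \<in> carrier_mat m n \<Longrightarrow> mat_adjoint A \<in> carrier_mat n m"
  by (auto simp: mat_adjoint_def)

lemma mat_adjoint_index:
  fixes A :: "complex mat"
  assumes "A \<in> carrier_mat m n" "j < n" "i < m"
  shows "mat_adjoint A $$ (j, i) = cnj (A $$ (i, j))"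
  using assms by (auto simp: mat_adjoint_def mat_of_rows_def)

lemma adjoint_weight_mult_vec_index:
  assumes F: "F \<in> carrier_mat m n" and v: "v \<in> carrier_vec m" and j: "j < n"
  shows "(mat_adjoint F * mat_diag m w *\<^sub>v v) $ j = (\<Sum>i<m. cnj (F $$ (i, j)) * w i * v $ i)"
  using assms mat_adjoint_carrier[OF F]
  by (simp add: mat_diag_mult_right[of _ n m] scalar_prod_def mat_adjoint_index[OF F] atLeast0LessThan)

definition normal_mat :: "complex mat \<Rightarrow> (nat \<Rightarrow> real) \<Rightarrow> (nat \<Rightarrow> real) \<Rightarrow> real \<Rightarrow> complex mat" where
  "normal_mat F w u lam =
     mat_adjoint F * mat_diag (dim_row F) (\<lambda>i. of_real (w i)) * F
       + complex_of_real lam \<cdot>\<^sub>m mat_diag (dim_col F) (\<lambda>j. of_real (u j))"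

lemma normal_mat_carrier [simp]: "F \<in> carrier_mat m n \<Longrightarrow> normal_mat F w u lam \<in> carrier_mat n n"
  by (auto simp: normal_mat_def mat_diag_def)

lemma normal_mat_mult_vec_index:
  assumes F: "F \<in> carrier_mat m n" and v: "v \<in> carrier_vec n" and j: "j < n"
  shows "(normal_mat F w u lam *\<^sub>v v) $ j =
    (\<Sum>i<m. cnj (F $$ (i, j)) * of_real (w i) * (F *\<^sub>v v) $ i) + of_real lam * of_real (u j) * v $ j"
proof -
  let ?B = "mat_adjoint F * mat_diag m (\<lambda>i. complex_of_real (w i))"
  let ?D = "complex_of_real lam \<cdot>\<^sub>m mat_diag n (\<lambda>j. of_real (u j))"
  have B: "?B \<in> carrier_mat n m"
    using mat_adjoint_carrier[OF F] by (rule mult_carrier_mat) simp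
  have D: "?D \<in> carrier_mat n n" by (simp add: mat_diag_def)
  have Fv: "F *\<^sub>v v \<in> carrier_vec m" using F v by simp
  have "normal_mat F w u lam *\<^sub>v v = ?B *\<^sub>v (F *\<^sub>v v) + ?D *\<^sub>v v"
    using F v B D by (simp add: normal_mat_def add_mult_distrib_mat_vec[of _ n n] assoc_mult_mat_vec[of _ n m])
  moreover have "(?D *\<^sub>v v) $ j = of_real lam * of_real (u j) * v $ j"
  proof -
    have "?D = Matrix.mat n n (\<lambda>(i, k). if i = k then of_real lam * of_real (u k) else 0)"
      by (rule eq_matI) (auto simp: mat_diag_def)
    then have "(?D *\<^sub>v v) $ j = (\<Sum>k<n. (if j = k then of_real lam * of_real (u k) else 0) * v $ k)"
      using v j by (simp add: scalar_prod_def atLeast0LessThan)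
    also have "\<dots> = (\<Sum>k<n. if j = k then of_real lam * of_real (u j) * v $ k else 0)"
      by (intro sum.cong) auto
    also have "\<dots> = of_real lam * of_real (u j) * v $ j"
      using j by (simp add: sum.delta)
    finally show ?thesis .
  qed
  ultimately show ?thesis
    using adjoint_weight_mult_vec_index[OF F Fv j] j carrier_vecD[OF mult_mat_vec_carrier[OF D v]] by simp
qed

lemma inv_mat_inverts:
  assumes A: "A \<in> carrier_mat n n"
    and inj: "\<And>v. v \<in> carrier_vec n \<Longrightarrow> A *\<^sub>v v = 0\<^sub>v n \<Longrightarrow> v = 0\<^sub>v n"
  shows "inv_mat A \<in> carrier_mat n n" "A * inv_mat A = 1\<^sub>m n" "inv_mat A * A = 1\<^sub>m n"
proof -
  have "det A \<noteq> 0"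
    using det_0_iff_vec_prod_zero[OF A] inj by blast
  then have "A \<in> Units (ring_mat TYPE(complex) n ())"
    by (rule det_non_zero_imp_unit[OF A])
  then obtain B where "mat_inverse A = Some B"
    using mat_inverse(1)[OF A, where b = "()"] by (cases "mat_inverse A") auto
  with mat_inverse(2)[OF A this]
  show "inv_mat A \<in> carrier_mat n n" "A * inv_mat A = 1\<^sub>m n" "inv_mat A * A = 1\<^sub>m n"
    by (simp_all add: inv_mat_def)
qed

text \<open>The quadratic form of \<open>normal_mat\<close> at \<open>v\<close> is \<open>\<Sum>\<^sub>i w\<^sub>i |(F v)\<^sub>i|\<^sup>2 + \<lambda> \<Sum>\<^sub>j u\<^sub>j |v\<^sub>j|\<^sup>2\<close>, and the second sum
  is positive unless \<open>v\<close> vanishes.  Positivity comes from the penalty alone, so the argument also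
  covers a design from which a node has been removed.\<close>

lemma normal_mat_inj:
  assumes F: "F \<in> carrier_mat m n" and v: "v \<in> carrier_vec n"
    and w: "\<And>i. i < m \<Longrightarrow> w i \<ge> 0" and u: "\<And>j. j < n \<Longrightarrow> u j > 0" and lam: "lam > 0"
    and zero: "normal_mat F w u lam *\<^sub>v v = 0\<^sub>v n"
  shows "v = 0\<^sub>v n"
proof -
  have cmod_sq: "cnj z * z = of_real ((cmod z)\<^sup>2)" for z
    by (metis complex_norm_square mult.commute of_real_power)
  let ?r = "(\<Sum>i<m. w i * (cmod ((F *\<^sub>v v) $ i))\<^sup>2) + lam * (\<Sum>j<n. u j * (cmod (v $ j))\<^sup>2)"
  have Fv: "(F *\<^sub>v v) $ i = (\<Sum>j<n. F $$ (i, j) * v $ j)" if "i < m" for i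
    using F v that by (simp add: scalar_prod_def atLeast0LessThan)
  have "0 = (\<Sum>j<n. cnj (v $ j) * (normal_mat F w u lam *\<^sub>v v) $ j)"
    by (simp add: zero)
  also have "\<dots> = (\<Sum>j<n. cnj (v $ j) * (\<Sum>i<m. cnj (F $$ (i, j)) * of_real (w i) * (F *\<^sub>v v) $ i))
      + (\<Sum>j<n. cnj (v $ j) * (of_real lam * of_real (u j) * v $ j))"
    by (simp add: normal_mat_mult_vec_index[OF F v] distrib_left sum.distrib)
  also have "(\<Sum>j<n. cnj (v $ j) * (\<Sum>i<m. cnj (F $$ (i, j)) * of_real (w i) * (F *\<^sub>v v) $ i))
      = (\<Sum>i<m. of_real (w i) * (F *\<^sub>v v) $ i * cnj (\<Sum>j<n. F $$ (i, j) * v $ j))"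
    unfolding sum_distrib_left cnj_sum by (subst sum.swap) (simp add: mult_ac)
  also have "\<dots> = (\<Sum>i<m. of_real (w i) * of_real ((cmod ((F *\<^sub>v v) $ i))\<^sup>2))"
  proof (rule sum.cong)
    fix i assume "i \<in> {..<m}"
    then show "of_real (w i) * (F *\<^sub>v v) $ i * cnj (\<Sum>j<n. F $$ (i, j) * v $ j)
        = of_real (w i) * of_real ((cmod ((F *\<^sub>v v) $ i))\<^sup>2)"
      unfolding cmod_sq[symmetric] by (subst Fv[symmetric]) (simp_all add: mult_ac)
  qed simp
  also have "(\<Sum>j<n. cnj (v $ j) * (of_real lam * of_real (u j) * v $ j))
      = of_real lam * (\<Sum>j<n. of_real (u j) * of_real ((cmod (v $ j))\<^sup>2))"
    unfolding sum_distrib_left cmod_sq[symmetric] by (rule sum.cong) (simp_all add: mult_ac)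
  finally have "complex_of_real ?r = 0"
    by simp
  then have "?r = 0"
    using of_real_eq_0_iff by blast
  moreover have "(\<Sum>i<m. w i * (cmod ((F *\<^sub>v v) $ i))\<^sup>2) \<ge> 0"
    using w by (intro sum_nonneg) auto
  moreover have nonneg: "u j * (cmod (v $ j))\<^sup>2 \<ge> 0" if "j < n" for j
    using u[OF that] by simp
  moreover from nonneg have "(\<Sum>j<n. u j * (cmod (v $ j))\<^sup>2) \<ge> 0"
    by (intro sum_nonneg) auto
  ultimately have "(\<Sum>j<n. u j * (cmod (v $ j))\<^sup>2) = 0"
    using lam by (smt (verit) mult_pos_pos)
  then have "u j * (cmod (v $ j))\<^sup>2 = 0" if "j < n" for j
    using nonneg that by (subst (asm) sum_nonneg_eq_0_iff) auto
  then have "v $ j = 0" if "j < n" for j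
    using that u[OF that] by (metis less_irrefl mult_eq_0_iff norm_eq_zero zero_eq_power2)
  then show ?thesis
    using v by (intro eq_vecI) auto
qed

lemma regularized_solve_carrier:
  assumes F: "F \<in> carrier_mat m n"
    and w: "\<And>i. i < m \<Longrightarrow> w i \<ge> 0" and u: "\<And>j. j < n \<Longrightarrow> u j > 0" and lam: "lam > 0"
  shows "regularized_solve F (mat_diag m (\<lambda>i. of_real (w i))) (mat_diag n (\<lambda>j. of_real (u j))) lam
     \<in> carrier_mat n m"
proof -
  have "inv_mat (normal_mat F w u lam) \<in> carrier_mat n n"
    by (rule inv_mat_inverts(1)[OF normal_mat_carrier[OF F] normal_mat_inj[OF F _ w u lam]])
  then show ?thesis
    using F mat_adjoint_carrier[OF F]
    by (simp add: regularized_solve_def normal_mat_def mult_carrier_mat[of _ n n] mult_carrier_mat[of _ n m])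
qed

text \<open>The normal equations in residual form: the node \<open>i\<close> enters only through its residual
  \<open>(F v)\<^sub>i - f\<^sub>i\<close>.  All later statements about fits are derived from this criterion, so that no
  inverse matrix is ever computed.\<close>

lemma regularized_solve_eq_iff:
  assumes F: "F \<in> carrier_mat m n" and f: "f \<in> carrier_vec m" and v: "v \<in> carrier_vec n"
    and w: "\<And>i. i < m \<Longrightarrow> w i \<ge> 0" and u: "\<And>j. j < n \<Longrightarrow> u j > 0" and lam: "lam > 0"
  shows "regularized_solve F (mat_diag m (\<lambda>i. of_real (w i))) (mat_diag n (\<lambda>j. of_real (u j))) lam *\<^sub>v f = v
    \<longleftrightarrow> (\<forall>j<n. (\<Sum>i<m. cnj (F $$ (i, j)) * of_real (w i) * ((F *\<^sub>v v) $ i - f $ i))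
              + of_real lam * of_real (u j) * v $ j = 0)"
proof -
  let ?N = "normal_mat F w u lam"
  let ?B = "mat_adjoint F * mat_diag m (\<lambda>i. complex_of_real (w i))"
  have N: "?N \<in> carrier_mat n n" using F by simp
  have inv: "inv_mat ?N \<in> carrier_mat n n" "?N * inv_mat ?N = 1\<^sub>m n" "inv_mat ?N * ?N = 1\<^sub>m n"
    by (rule inv_mat_inverts[OF N normal_mat_inj[OF F _ w u lam]]; assumption)+
  have B: "?B \<in> carrier_mat n m"
    using mat_adjoint_carrier[OF F] by (rule mult_carrier_mat) simp
  have Bf: "?B *\<^sub>v f \<in> carrier_vec n" using B f by simp
  have "regularized_solve F (mat_diag m (\<lambda>i. of_real (w i))) (mat_diag n (\<lambda>j. of_real (u j))) lam
      = inv_mat ?N * ?B"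
    using F inv(1) mat_adjoint_carrier[OF F]
    by (simp add: regularized_solve_def normal_mat_def assoc_mult_mat[of _ n n _ m _ m])
  then have "regularized_solve F (mat_diag m (\<lambda>i. of_real (w i))) (mat_diag n (\<lambda>j. of_real (u j))) lam *\<^sub>v f
      = inv_mat ?N *\<^sub>v (?B *\<^sub>v f)"
    using inv(1) B f by (simp add: assoc_mult_mat_vec[of _ n n _ m])
  also have "\<dots> = v \<longleftrightarrow> ?N *\<^sub>v v = ?B *\<^sub>v f"
  proof
    assume "inv_mat ?N *\<^sub>v (?B *\<^sub>v f) = v"
    then have "?N *\<^sub>v v = (?N * inv_mat ?N) *\<^sub>v (?B *\<^sub>v f)"
      using N inv(1) Bf by (simp add: assoc_mult_mat_vec[of _ n n _ n])
    then show "?N *\<^sub>v v = ?B *\<^sub>v f"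
      using inv(2) Bf by simp
  next
    assume "?N *\<^sub>v v = ?B *\<^sub>v f"
    then have "inv_mat ?N *\<^sub>v (?B *\<^sub>v f) = (inv_mat ?N * ?N) *\<^sub>v v"
      using N inv(1) v by (simp add: assoc_mult_mat_vec[of _ n n _ n])
    then show "inv_mat ?N *\<^sub>v (?B *\<^sub>v f) = v"
      using inv(3) v by simp
  qed
  also have "\<dots> \<longleftrightarrow> (\<forall>j<n. (?N *\<^sub>v v) $ j = (?B *\<^sub>v f) $ j)"
  proof -
    have "a = b \<longleftrightarrow> (\<forall>j<n. a $ j = b $ j)" if "a \<in> carrier_vec n" "b \<in> carrier_vec n"
      for a b :: "complex Matrix.vec"
      using that by (auto intro!: eq_vecI)
    then show ?thesis
      using N v Bf by (metis mult_mat_vec_carrier)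
  qed
  also have "\<dots> \<longleftrightarrow> (\<forall>j<n. (\<Sum>i<m. cnj (F $$ (i, j)) * of_real (w i) * ((F *\<^sub>v v) $ i - f $ i))
              + of_real lam * of_real (u j) * v $ j = 0)"
    by (simp add: normal_mat_mult_vec_index[OF F v] adjoint_weight_mult_vec_index[OF F f]
        right_diff_distrib sum_subtractf algebra_simps eq_diff_eq cong: sum.cong)
  finally show ?thesis .
qed

lemma sum_insert_index:
  fixes g :: "nat \<Rightarrow> 'a::comm_monoid_add"
  assumes "i < m"
  shows "(\<Sum>k<m - 1. g (insert_index i k)) = (\<Sum>k\<in>{..<m} - {i}. g k)"
proof (rule sum.reindex_bij_betw)
  show "bij_betw (insert_index i) {..<m - 1} ({..<m} - {i})"
    using assms by (intro bij_betw_byWitness[where f' = "delete_index i"])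
      (auto simp: insert_index_def delete_index_def)
qed

section \<open>Hat matrix and leave-one-out fits\<close>

text \<open>The nodes are \<open>{..<m}\<close> with weights \<open>w\<close>, the coefficients are \<open>{..<n}\<close> with penalties \<open>u\<close>.  Indices
  instead of points make the design without one node an instance of the same locale.\<close>

locale ridge_fit =
  fixes F :: "complex mat" and m n :: nat and w u :: "nat \<Rightarrow> real" and lam :: real
  assumes F: "F \<in> carrier_mat m n"
    and w_nonneg: "\<And>i. i < m \<Longrightarrow> w i \<ge> 0"
    and u_pos: "\<And>j. j < n \<Longrightarrow> u j > 0"
    and lam_pos: "lam > 0"
begin

definition solve :: "complex mat" where
  "solve = regularized_solve F (mat_diag m (\<lambda>i. of_real (w i))) (mat_diag n (\<lambda>j. of_real (u j))) lam"

definition hat :: "complex mat" where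
  "hat = F * solve"

lemma solve_carrier: "solve \<in> carrier_mat n m"
  unfolding solve_def by (rule regularized_solve_carrier[OF F w_nonneg u_pos lam_pos])

lemma hat_carrier: "hat \<in> carrier_mat m m"
  unfolding hat_def using F solve_carrier by (rule mult_carrier_mat)

lemma hat_mult_vec: "f \<in> carrier_vec m \<Longrightarrow> hat *\<^sub>v f = F *\<^sub>v (solve *\<^sub>v f)"
  unfolding hat_def using F solve_carrier by (rule assoc_mult_mat_vec)

lemma solve_eq_iff:
  assumes "f \<in> carrier_vec m" "v \<in> carrier_vec n"
  shows "solve *\<^sub>v f = v \<longleftrightarrow>
    (\<forall>j<n. (\<Sum>i<m. cnj (F $$ (i, j)) * of_real (w i) * ((F *\<^sub>v v) $ i - f $ i))
              + of_real lam * of_real (u j) * v $ j = 0)"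
  unfolding solve_def by (rule regularized_solve_eq_iff[OF F assms w_nonneg u_pos lam_pos])

lemma without_node:
  assumes "i < m"
  shows "ridge_fit (delete_row F i) (m - 1) n (\<lambda>k. w (insert_index i k)) u lam"
  using F w_nonneg u_pos lam_pos assms
  by unfold_locales (auto simp: delete_row_def insert_index_def)

text \<open>Replacing \<open>f\<^sub>i\<close> by the prediction of the fit without node \<open>i\<close> makes the residual at \<open>i\<close> zero.  The full
  normal equations for these data then have the same terms as the normal equations without node
  \<open>i\<close>, so both problems have the same solution.\<close>

lemma hat_leave_one_out:
  assumes i: "i < m" and f: "f \<in> carrier_vec m"
  defines "v \<equiv> ridge_fit.solve (delete_row F i) (m - 1) n (\<lambda>k. w (insert_index i k)) u lam
      *\<^sub>v delete_entry f i"
  shows "F *\<^sub>v v = hat *\<^sub>v Matrix.vec m (\<lambda>k. if k = i then (F *\<^sub>v v) $ i else f $ k)"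
proof -
  interpret del: ridge_fit "delete_row F i" "m - 1" n "\<lambda>k. w (insert_index i k)" u lam
    by (rule without_node[OF i])
  let ?f' = "Matrix.vec m (\<lambda>k. if k = i then (F *\<^sub>v v) $ i else f $ k)"
  have del_f: "delete_entry f i \<in> carrier_vec (m - 1)"
    using f by (simp add: delete_entry_def carrier_vecD)
  have v: "v \<in> carrier_vec n"
    unfolding v_def using del.solve_carrier del_f by (rule mult_mat_vec_carrier)
  have less: "insert_index i k < m" if "k < m - 1" for k
    using that by (auto simp: insert_index_def)
  have pred: "(delete_row F i *\<^sub>v v) $ k = (F *\<^sub>v v) $ insert_index i k" if "k < m - 1" for k
    using F v that less[OF that] by (simp add: delete_row_def scalar_prod_def)
  have "solve *\<^sub>v ?f' = v"
  proof (subst solve_eq_iff)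
    show "\<forall>j<n. (\<Sum>k<m. cnj (F $$ (k, j)) * of_real (w k) * ((F *\<^sub>v v) $ k - ?f' $ k))
              + of_real lam * of_real (u j) * v $ j = 0"
    proof (intro allI impI)
      fix j assume j: "j < n"
      let ?r = "\<lambda>k. cnj (F $$ (k, j)) * of_real (w k) * ((F *\<^sub>v v) $ k - f $ k)"
      have "(\<Sum>k<m. cnj (F $$ (k, j)) * of_real (w k) * ((F *\<^sub>v v) $ k - ?f' $ k))
          = (\<Sum>k\<in>{..<m} - {i}. ?r k)"
        using i by (subst sum.remove[of _ i]) (auto intro!: sum.cong)
      also have "\<dots> = (\<Sum>k<m - 1. ?r (insert_index i k))"
        by (rule sum_insert_index[OF i, symmetric])
      also have "\<dots> = (\<Sum>k<m - 1. cnj (delete_row F i $$ (k, j)) * of_real (w (insert_index i k))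
          * ((delete_row F i *\<^sub>v v) $ k - delete_entry f i $ k))"
        using F f j
        by (intro sum.cong refl) (simp add: pred del: index_mult_mat_vec, simp add: delete_row_def delete_entry_def)
      finally show "(\<Sum>k<m. cnj (F $$ (k, j)) * of_real (w k) * ((F *\<^sub>v v) $ k - ?f' $ k))
              + of_real lam * of_real (u j) * v $ j = 0"
        using del.solve_eq_iff[OF del_f v] j unfolding v_def by simp
    qed
  qed (use v in simp_all)
  then show ?thesis
    by (simp add: hat_mult_vec)
qed

text \<open>The data vectors in \<open>hat_leave_one_out\<close> and in the full fit differ only at \<open>i\<close>, by
  \<open>(F v)\<^sub>i - f\<^sub>i\<close>, which changes the prediction at \<open>i\<close> by \<open>h\<^sub>i\<^sub>i\<close> times this difference.\<close>

lemma leave_one_out_residual: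
  assumes i: "i < m" and f: "f \<in> carrier_vec m"
  defines "v \<equiv> ridge_fit.solve (delete_row F i) (m - 1) n (\<lambda>k. w (insert_index i k)) u lam
      *\<^sub>v delete_entry f i"
  shows "(1 - hat $$ (i, i)) * ((F *\<^sub>v v) $ i - f $ i) = (hat *\<^sub>v f) $ i - f $ i"
proof -
  let ?f' = "\<lambda>k. if k = i then (F *\<^sub>v v) $ i else f $ k"
  have "(F *\<^sub>v v) $ i = (hat *\<^sub>v Matrix.vec m ?f') $ i"
    unfolding v_def by (subst hat_leave_one_out[OF i f]) simp
  also have "\<dots> = (\<Sum>k<m. hat $$ (i, k) * ?f' k)"
    using hat_carrier i by (simp add: scalar_prod_def atLeast0LessThan)
  also have "\<dots> = (\<Sum>k<m. hat $$ (i, k) * f $ k) + hat $$ (i, i) * ((F *\<^sub>v v) $ i - f $ i)"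
    using i by (subst (1 2) sum.remove[of _ i]) (auto simp: algebra_simps intro!: sum.cong)
  also have "(\<Sum>k<m. hat $$ (i, k) * f $ k) = (hat *\<^sub>v f) $ i"
    using hat_carrier i f by (simp add: scalar_prod_def atLeast0LessThan)
  finally show ?thesis
    by (simp add: algebra_simps)
qed

end

section \<open>Orthonormal designs with unimodular entries\<close>

locale orthonormal_fit = ridge_fit +
  assumes gram: "\<And>j l. j < n \<Longrightarrow> l < n \<Longrightarrow>
      (\<Sum>i<m. cnj (F $$ (i, j)) * of_real (w i) * F $$ (i, l)) = (if j = l then 1 else 0)"
    and unimodular: "\<And>i j. i < m \<Longrightarrow> j < n \<Longrightarrow> cmod (F $$ (i, j)) = 1"
begin

lemma denominator_nonzero: "j < n \<Longrightarrow> 1 + complex_of_real lam * of_real (u j) \<noteq> 0"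
proof -
  assume "j < n"
  then have "1 + lam * u j > 0"
    using u_pos lam_pos by (simp add: add_pos_pos)
  then have "complex_of_real (1 + lam * u j) \<noteq> 0"
    by (simp only: of_real_eq_0_iff)
  then show ?thesis
    by simp
qed

lemma solve_mult_vec:
  assumes f: "f \<in> carrier_vec m"
  shows "solve *\<^sub>v f = Matrix.vec n (\<lambda>j. (\<Sum>i<m. cnj (F $$ (i, j)) * of_real (w i) * f $ i)
    / (1 + of_real lam * of_real (u j)))" (is "_ = ?v")
proof (subst solve_eq_iff[OF f])
  show "\<forall>j<n. (\<Sum>i<m. cnj (F $$ (i, j)) * of_real (w i) * ((F *\<^sub>v ?v) $ i - f $ i))
              + of_real lam * of_real (u j) * ?v $ j = 0"
  proof (intro allI impI)
    fix j assume j: "j < n"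
    \<comment> \<open>By the Gram relation \<open>F\<^sup>H W F\<close> acts as the identity, which decouples the equations.\<close>
    have "(\<Sum>i<m. cnj (F $$ (i, j)) * of_real (w i) * (F *\<^sub>v ?v) $ i)
        = (\<Sum>i<m. cnj (F $$ (i, j)) * of_real (w i) * (\<Sum>l<n. F $$ (i, l) * ?v $ l))"
      using F by (intro sum.cong) (auto simp: scalar_prod_def atLeast0LessThan)
    also have "\<dots> = (\<Sum>l<n. (\<Sum>i<m. cnj (F $$ (i, j)) * of_real (w i) * F $$ (i, l)) * ?v $ l)"
      unfolding sum_distrib_left sum_distrib_right by (subst sum.swap) (simp add: mult_ac)
    also have "\<dots> = (\<Sum>l<n. if j = l then ?v $ l else 0)"
      by (rule sum.cong) (auto simp: gram j)
    also have "\<dots> = ?v $ j"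
      using j by (simp add: sum.delta)
    finally have "(\<Sum>i<m. cnj (F $$ (i, j)) * of_real (w i) * (F *\<^sub>v ?v) $ i) = ?v $ j" .
    moreover have "(1 + of_real lam * of_real (u j)) * ?v $ j
        = (\<Sum>i<m. cnj (F $$ (i, j)) * of_real (w i) * f $ i)"
      using j denominator_nonzero[OF j] by simp
    ultimately show "(\<Sum>i<m. cnj (F $$ (i, j)) * of_real (w i) * ((F *\<^sub>v ?v) $ i - f $ i))
              + of_real lam * of_real (u j) * ?v $ j = 0"
      unfolding right_diff_distrib sum_subtractf by (simp only: distrib_right mult_1) (simp only: algebra_simps add_0_left)
  qed
qed simp

lemma hat_diag:
  assumes i: "i < m"
  shows "hat $$ (i, i) = of_real (w i * (\<Sum>j<n. 1 / (1 + lam * u j)))"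
proof -
  have e: "unit_vec m i \<in> carrier_vec m" by simp
  have "hat $$ (i, i) = (hat *\<^sub>v unit_vec m i) $ i"
    using hat_carrier i by simp
  also have "\<dots> = (F *\<^sub>v (solve *\<^sub>v unit_vec m i)) $ i"
    by (simp only: hat_mult_vec[OF e])
  also have "\<dots> = (\<Sum>j<n. F $$ (i, j) *
      ((\<Sum>k<m. cnj (F $$ (k, j)) * of_real (w k) * unit_vec m i $ k) / (1 + of_real lam * of_real (u j))))"
    unfolding solve_mult_vec[OF e] using F i by (simp add: scalar_prod_def atLeast0LessThan)
  also have "\<dots> = (\<Sum>j<n. of_real (w i) * (1 / (1 + of_real lam * of_real (u j))))"
  proof (rule sum.cong)
    fix j assume "j \<in> {..<n}"
    then have "F $$ (i, j) * cnj (F $$ (i, j)) = 1"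
      using unimodular[OF i, of j] by (simp flip: complex_norm_square)
    moreover have "(\<Sum>k<m. cnj (F $$ (k, j)) * of_real (w k) * unit_vec m i $ k)
        = cnj (F $$ (i, j)) * of_real (w i)"
    proof -
      have "(\<Sum>k<m. cnj (F $$ (k, j)) * of_real (w k) * unit_vec m i $ k)
          = (\<Sum>k<m. if i = k then cnj (F $$ (k, j)) * of_real (w k) else 0)"
        by (rule sum.cong) (auto simp: unit_vec_def)
      then show ?thesis using i by (simp add: sum.delta)
    qed
    ultimately show "F $$ (i, j) *
      ((\<Sum>k<m. cnj (F $$ (k, j)) * of_real (w k) * unit_vec m i $ k) / (1 + of_real lam * of_real (u j)))
      = of_real (w i) * (1 / (1 + of_real lam * of_real (u j)))"
      by (simp add: mult.assoc[symmetric])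
  qed simp
  finally show ?thesis
    by (simp add: sum_distrib_left)
qed

text \<open>Bessel's inequality for the row of node \<open>i\<close>.  Let \<open>k\<^sub>l\<close> be the inner product of the rows \<open>l\<close> and \<open>i\<close>
  of \<open>F\<close>.  Orthonormality of the columns gives \<open>\<Sum>\<^sub>l w\<^sub>l |k\<^sub>l|\<^sup>2 = n\<close>, and since
  \<open>k\<^sub>i = n\<close> the single term \<open>l = i\<close> of this sum is already \<open>w\<^sub>i n\<^sup>2\<close>.\<close>

lemma leverage_bound:
  assumes i: "i < m"
  shows "w i * real n \<le> 1"
proof -
  have unit: "F $$ (i, j) * cnj (F $$ (i, j)) = 1" if "j < n" for j
    using unimodular[OF i that] by (simp flip: complex_norm_square)
  define k where "k l = (\<Sum>j<n. F $$ (l, j) * cnj (F $$ (i, j)))" for l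
  have "complex_of_real (\<Sum>l<m. w l * (cmod (k l))\<^sup>2) = (\<Sum>l<m. of_real (w l) * (k l * cnj (k l)))"
    by (simp flip: complex_norm_square)
  also have "\<dots> = (\<Sum>l<m. \<Sum>j<n. \<Sum>j'<n. cnj (F $$ (i, j)) * F $$ (i, j') *
      (cnj (F $$ (l, j')) * of_real (w l) * F $$ (l, j)))"
    unfolding k_def cnj_sum sum_product by (simp add: sum_distrib_left mult_ac)
  also have "\<dots> = (\<Sum>j<n. \<Sum>l<m. \<Sum>j'<n. cnj (F $$ (i, j)) * F $$ (i, j') *
      (cnj (F $$ (l, j')) * of_real (w l) * F $$ (l, j)))"
    by (rule sum.swap)
  also have "\<dots> = (\<Sum>j<n. \<Sum>j'<n. cnj (F $$ (i, j)) * F $$ (i, j') *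
      (\<Sum>l<m. cnj (F $$ (l, j')) * of_real (w l) * F $$ (l, j)))"
    unfolding sum_distrib_left by (intro sum.cong refl sum.swap)
  also have "\<dots> = (\<Sum>j<n. \<Sum>j'<n. if j' = j then cnj (F $$ (i, j)) * F $$ (i, j') else 0)"
    by (intro sum.cong refl) (simp add: gram)
  also have "\<dots> = (\<Sum>j<n. 1)"
    by (intro sum.cong refl) (simp add: unit mult.commute)
  also have "\<dots> = complex_of_real (real n)"
    by simp
  finally have total: "(\<Sum>l<m. w l * (cmod (k l))\<^sup>2) = real n"
    by (simp only: of_real_eq_iff)
  have "k i = (\<Sum>j<n. 1)"
    unfolding k_def by (intro sum.cong refl) (simp add: unit)
  then have "(cmod (k i))\<^sup>2 = (real n)\<^sup>2"
    by simp
  moreover have "w i * (cmod (k i))\<^sup>2 \<le> (\<Sum>l<m. w l * (cmod (k l))\<^sup>2)"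
    using i w_nonneg by (intro member_le_sum) auto
  ultimately have "(w i * real n) * real n \<le> 1 * real n"
    using total by (simp add: power2_eq_square)
  then show ?thesis
    by (cases "n = 0") (auto simp: mult_le_cancel_right)
qed

lemma hat_diag_less_1:
  assumes i: "i < m"
  shows "w i * (\<Sum>j<n. 1 / (1 + lam * u j)) < 1"
proof (cases "n = 0 \<or> w i = 0")
  case False
  then have "(\<Sum>j<n. 1 / (1 + lam * u j)) < (\<Sum>j<n. 1)"
    using u_pos lam_pos by (intro sum_strict_mono) (auto simp: divide_simps add_pos_pos)
  with False w_nonneg[OF i] have "w i * (\<Sum>j<n. 1 / (1 + lam * u j)) < w i * real n"
    by (intro mult_strict_left_mono) auto
  also have "\<dots> \<le> 1"
    by (rule leverage_bound[OF i])
  finally show ?thesis .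
qed auto

end

section \<open>Characters of the torus and exact quadrature\<close>

lemma finite_measure_unit_interval: "finite_measure (restrict_space lborel {0..<1::real})"
  by (rule finite_measureI) (simp add: emeasure_restrict_space)

lemma character_measurable:
  "(\<lambda>x. exp (2 * of_real pi * \<i> * of_real (of_int k * x))) \<in> borel_measurable (restrict_space lborel {0..<1::real})"
proof (rule measurable_restrict_space1)
  have "continuous_on UNIV (\<lambda>x::real. exp (2 * of_real pi * \<i> * of_real (of_int k * x) :: complex))"
    by (intro continuous_intros)
  then show "(\<lambda>x. exp (2 * of_real pi * \<i> * of_real (of_int k * x))) \<in> borel_measurable lborel"
    using borel_measurable_continuous_onI by simp
qed

lemma integrable_character:
  "integrable (restrict_space lborel {0..<1::real}) (\<lambda>x. exp (2 * of_real pi * \<i> * of_real (of_int k * x)))"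
proof -
  interpret finite_measure "restrict_space lborel {0..<1::real}"
    by (rule finite_measure_unit_interval)
  show ?thesis
    by (rule integrable_const_bound[where B = 1, OF _ character_measurable]) simp
qed

lemma integral_character:
  "(LINT x|restrict_space lborel {0..<1::real}. exp (2 * of_real pi * \<i> * of_real (of_int k * x)))
     = (if k = 0 then 1 else 0 :: complex)"
proof -
  define c where "c = 2 * of_real pi * \<i> * of_int k"
  have exp_eq: "exp (2 * of_real pi * \<i> * of_real (of_int k * x)) = exp (c * of_real x)" for x
    by (simp add: c_def mult.assoc)
  have meas: "(\<lambda>x::real. exp (c * of_real x)) \<in> borel_measurable borel"
    by (intro borel_measurable_continuous_onI continuous_intros)
  let ?G = "\<lambda>x::real. if k = 0 then of_real x else exp (c * of_real x) / c"
  have "(LINT x|restrict_space lborel {0..<1::real}. exp (c * of_real x))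
      = (LINT x|lborel. indicator {0..<1} x *\<^sub>R exp (c * of_real x))"
    by (rule integral_restrict_space) simp
  also have "\<dots> = (LINT x|lborel. indicator {0..1} x *\<^sub>R exp (c * of_real x))"
  proof (rule integral_cong_AE)
    show "AE x in lborel. indicator {0..<1} x *\<^sub>R exp (c * of_real x) = indicator {0..1} x *\<^sub>R exp (c * of_real x)"
      using AE_lborel_singleton[of "1::real"] by eventually_elim (auto simp: indicator_def)
  qed (use meas in simp_all)
  also have "\<dots> = ?G 1 - ?G 0"
  proof (rule integral_FTC_Icc)
    show "(?G has_vector_derivative exp (c * of_real x)) (at x within {0..1})" for x
    proof (cases "k = 0")
      case True
      then have "c = 0" by (simp add: c_def)
      have "((\<lambda>x. complex_of_real x) has_vector_derivative 1) (at x within {0..1})"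
        using has_vector_derivative_real_field[where f = "\<lambda>z::complex. z" and f' = 1, OF DERIV_ident]
        by simp
      then show ?thesis using True \<open>c = 0\<close> by simp
    next
      case False
      then have "c \<noteq> 0" by (simp add: c_def)
      then have "((\<lambda>z. exp (c * z) / c) has_field_derivative exp (c * of_real x)) (at (of_real x))"
        by (auto intro!: derivative_eq_intros)
      from has_vector_derivative_real_field[OF this] show ?thesis using False by simp
    qed
  qed (auto intro!: continuous_intros)
  also have "\<dots> = (if k = 0 then 1 else 0)"
  proof -
    have "exp c = 1"
      by (auto simp: c_def exp_eq_1 intro!: exI[of _ k])
    then show ?thesis by simp
  qed
  finally show ?thesis
    by (simp only: exp_eq)
qed

text \<open>A character of the torus is a product of one-dimensional characters, which lets Fubini's
  theorem reduce its integral to dimension one.\<close>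

lemma expo_eq_prod: "expo d k x = (\<Prod>j<d. exp (2 * of_real pi * \<i> * of_real (of_int (k j) * x j)))"
  by (simp only: expo_def of_real_sum sum_distrib_left exp_sum finite_lessThan)

lemma integral_expo: "(LINT x|torus_measure d. expo d k x) = (if \<forall>j<d. k j = 0 then 1 else 0)"
proof -
  interpret product_sigma_finite "\<lambda>j::nat. restrict_space lborel {0..<1::real}"
    using finite_measure.axioms(1)[OF finite_measure_unit_interval] by (rule product_sigma_finite.intro)
  have "(LINT x|torus_measure d. expo d k x) = (\<Prod>j<d. if k j = 0 then 1 else 0)"
    unfolding torus_measure_def expo_eq_prod integral_character[symmetric]
    by (rule product_integral_prod) (simp_all only: finite_lessThan integrable_character)
  also have "\<dots> = (if \<forall>j<d. k j = 0 then 1 else 0)"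
    by auto
  finally show ?thesis .
qed

lemma expo_diff: "expo d (\<lambda>j\<in>{..<d}. a j - b j) x = expo d a x * cnj (expo d b x)"
proof -
  have "(\<Sum>j<d. of_int ((\<lambda>j\<in>{..<d}. a j - b j) j) * x j) = (\<Sum>j<d. of_int (a j) * x j) - (\<Sum>j<d. of_int (b j) * x j)"
    unfolding sum_subtractf[symmetric] by (intro sum.cong) (auto simp: left_diff_distrib)
  then show ?thesis
    unfolding expo_def exp_cnj exp_add[symmetric] by (simp add: right_diff_distrib del: of_real_sum)
qed

lemma norm_expo: "cmod (expo d k x) = 1"
  unfolding expo_def by simp

lemma fourier_mat_carrier: "fourier_mat d xs ns \<in> carrier_mat (length xs) (length ns)"
  by (simp add: fourier_mat_def)

text \<open>The product of a character with a conjugate character is the character of the difference of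
  the frequencies, which belongs to the set for which the quadrature rule is exact.  The integral
  detects equality of the frequencies because multi-indices are determined by their first \<open>d\<close>
  coordinates.\<close>

lemma fourier_gram:
  assumes xs: "distinct xs" and ns: "distinct ns" "set ns \<subseteq> multi_indices d"
    and exact: "\<forall>k\<in>difference_set d (set ns). exact_for d (set xs) w (expo d k)"
    and j: "j < length ns" and l: "l < length ns"
  shows "(\<Sum>i<length xs. cnj (fourier_mat d xs ns $$ (i, j)) * of_real (w (xs ! i)) * fourier_mat d xs ns $$ (i, l))
    = (if j = l then 1 else 0)"
proof -
  let ?k = "\<lambda>p\<in>{..<d}. (ns ! l) p - (ns ! j) p"
  have "(\<Sum>i<length xs. cnj (fourier_mat d xs ns $$ (i, j)) * of_real (w (xs ! i)) * fourier_mat d xs ns $$ (i, l))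
      = (\<Sum>i<length xs. of_real (w (xs ! i)) * expo d ?k (xs ! i))"
    using j l by (intro sum.cong refl) (simp add: fourier_mat_def expo_diff)
  also have "\<dots> = (\<Sum>x\<in>set xs. of_real (w x) * expo d ?k x)"
    by (rule sum.reindex_bij_betw[OF bij_betw_nth[OF xs refl refl]])
  also have "\<dots> = (LINT x|torus_measure d. expo d ?k x)"
  proof -
    have "?k \<in> difference_set d (set ns)"
      using j l unfolding difference_set_def by (blast intro: nth_mem)
    then show ?thesis
      using exact by (simp add: exact_for_def)
  qed
  also have "\<dots> = (if \<forall>p<d. (ns ! l) p = (ns ! j) p then 1 else 0)"
    unfolding integral_expo by (simp cong: if_cong)
  also have "(\<forall>p<d. (ns ! l) p = (ns ! j) p) \<longleftrightarrow> ns ! l = ns ! j"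
  proof
    assume "\<forall>p<d. (ns ! l) p = (ns ! j) p"
    moreover have "ns ! l \<in> multi_indices d" "ns ! j \<in> multi_indices d"
      using ns(2) j l nth_mem by blast+
    ultimately show "ns ! l = ns ! j"
      unfolding multi_indices_def by (intro PiE_ext) auto
  qed simp
  also have "ns ! l = ns ! j \<longleftrightarrow> j = l"
    using ns(1) j l nth_eq_iff_index_eq by metis
  finally show ?thesis .
qed

section \<open>Running straight-line programs\<close>

lemma run_append:
  "run sub inp (p @ q) st = (case run sub inp p st of None \<Rightarrow> None | Some st' \<Rightarrow> run sub inp q st')"
  by (induction p arbitrary: st) (auto split: option.splits)

lemma run_output_length:
  "run sub inp p (s, out) = Some (s', out') \<Longrightarrow> length out' \<le> length out + cost_with c p"
proof (induction p arbitrary: s out)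
  case (Cons i p)
  then obtain s1 out1 where step: "step sub inp i (s, out) = Some (s1, out1)"
    and run: "run sub inp p (s1, out1) = Some (s', out')"
    by (auto split: option.splits)
  have "length out1 \<le> length out + instr_cost c i"
    using step by (cases i) (auto split: if_splits option.splits)
  with Cons.IH[OF run] show ?case
    by (simp add: cost_with_def)
qed simp

lemma eval_multiplies_with:
  assumes "multiplies_with p A" "A \<in> carrier_mat m n" "v \<in> carrier_vec n"
  shows "eval_prog no_subs p (list_of_vec v) = Some (list_of_vec (A *\<^sub>v v))"
  using assms by (auto simp: multiplies_with_def)

text \<open>Only \<^const>\<open>Output\<close> lengthens the output, by one entry at cost 1, and a program that
  multiplies with \<open>A\<close> has to output a vector of length \<^term>\<open>dim_row A\<close>.\<close>

lemma cost_ge_output_dim: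
  assumes "multiplies_with p A"
  shows "dim_row A \<le> cost [] p"
proof -
  have "eval_prog no_subs p (list_of_vec (0\<^sub>v (dim_col A))) = Some (list_of_vec (A *\<^sub>v 0\<^sub>v (dim_col A)))"
    using assms unfolding multiplies_with_def by (auto simp del: list_of_vec_0)
  then obtain s' where "run no_subs (list_of_vec (0\<^sub>v (dim_col A))) p init_state
      = Some (s', list_of_vec (A *\<^sub>v 0\<^sub>v (dim_col A)))"
    by (auto simp: eval_prog_def)
  from run_output_length[OF this[unfolded init_state_def]] show ?thesis
    by (simp add: cost_def)
qed

lemma cost_with_simps:
  "cost_with c [] = 0" "cost_with c (i # p) = instr_cost c i + cost_with c p"
  "cost_with c (p @ q) = cost_with c p + cost_with c q"
  by (simp_all add: cost_with_def)

text \<open>A total-correctness triple: from every memory satisfying \<open>P\<close> the program runs without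
  failure, writes no output and establishes \<open>Q\<close>.\<close>

definition triple ::
  "(nat \<Rightarrow> complex list \<Rightarrow> complex list option) \<Rightarrow> complex list \<Rightarrow> (memory \<Rightarrow> bool) \<Rightarrow> prog \<Rightarrow> (memory \<Rightarrow> bool)
    \<Rightarrow> bool" where
  "triple sub inp P p Q \<longleftrightarrow>
     (\<forall>s out. P s \<longrightarrow> (\<exists>s'. run sub inp p (s, out) = Some (s', out) \<and> Q s'))"

lemma triple_append:
  "triple sub inp P p Q \<Longrightarrow> triple sub inp Q q R \<Longrightarrow> triple sub inp P (p @ q) R"
  unfolding triple_def run_append by (metis (no_types, lifting) option.case(2))

text \<open>The loop is unrolled, which is legitimate since a program may depend on the numbers of
  nodes and frequencies.\<close>

definition for_loop :: "nat \<Rightarrow> (nat \<Rightarrow> prog) \<Rightarrow> prog" where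
  "for_loop k body = concat (map body [0..<k])"

lemma triple_for_loop:
  assumes "\<And>i. i < k \<Longrightarrow> triple sub inp (Inv i) (body i) (Inv (Suc i))"
  shows "triple sub inp (Inv 0) (for_loop k body) (Inv k)"
  using assms
proof (induction k)
  case 0
  show ?case by (simp add: triple_def for_loop_def)
next
  case (Suc k)
  then have "triple sub inp (Inv 0) (for_loop k body) (Inv k)"
    "triple sub inp (Inv k) (body k) (Inv (Suc k))" by auto
  from triple_append[OF this] show ?case
    by (simp add: for_loop_def)
qed

lemma cost_with_for_loop:
  assumes "\<And>i. cost_with c (body i) = b"
  shows "cost_with c (for_loop k body) = k * b"
  by (induction k) (simp_all add: for_loop_def cost_with_simps assms)

section \<open>The three phases of the algorithm\<close>

text \<open>Memory layout of all phases: in the first phase register 0 holds \<open>\<lambda>\<close>; register 1 holds the constant 1,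
  register 5 the mean of the diagonal of the hat matrix, and the other registers below 7 are
  temporaries.  From 7 on follow four blocks of length \<open>m\<close>, namely the predictions, the data, the
  node weights (later the diagonal of the hat matrix) and the weighted data, and two blocks of
  length \<open>n\<close>, namely the factors \<open>1 + \<lambda> u\<^sub>j\<close> and the coefficients.  Subroutine 0 multiplies with \<open>F\<close>
  and subroutine 1 with \<open>F\<^sup>H\<close>.\<close>

definition fit_prog :: "nat \<Rightarrow> nat \<Rightarrow> prog" where
  "fit_prog m n =
     [Input 0 (2 * m + n), Const 1 1]
     @ for_loop m (\<lambda>i. [Input (7 + 2 * m + i) i, Input (7 + m + i) (m + n + i),
         Mul (7 + 3 * m + i) (7 + 2 * m + i) (7 + m + i)])
     @ [Call 1 (7 + 3 * m) m (7 + 4 * m + n)]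
     @ for_loop n (\<lambda>j. [Input (7 + 4 * m + j) (m + j), Mul (7 + 4 * m + j) 0 (7 + 4 * m + j),
         Add (7 + 4 * m + j) 1 (7 + 4 * m + j),
         Div (7 + 4 * m + n + j) (7 + 4 * m + n + j) (7 + 4 * m + j)])
     @ [Call 0 (7 + 4 * m + n) n 7]"

text \<open>The memory between the first and the second phase: predictions \<open>z\<close>, data \<open>f\<close>, node weights \<open>w\<close> and
  the factors \<open>e\<close> by which coefficients have been divided.\<close>

definition fitted :: "nat \<Rightarrow> nat \<Rightarrow> (nat \<Rightarrow> complex) \<Rightarrow> (nat \<Rightarrow> complex) \<Rightarrow> (nat \<Rightarrow> complex)
    \<Rightarrow> (nat \<Rightarrow> complex) \<Rightarrow> memory \<Rightarrow> bool" where
  "fitted m n z f w e s \<longleftrightarrow> s 1 = 1 \<and>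
     (\<forall>i<m. s (7 + i) = z i \<and> s (7 + m + i) = f i \<and> s (7 + 2 * m + i) = w i) \<and>
     (\<forall>j<n. s (7 + 4 * m + j) = e j)"

text \<open>The assumptions on the subroutines are made only for the two vectors on which the program calls
  them: \<open>a\<close> stands for \<open>F\<^sup>H W f\<close> and \<open>z\<close> for the predictions \<open>H f\<close>.\<close>

lemma triple_fit_prog:
  assumes len: "length inp = 2 * m + n + 1"
    and w: "\<And>i. i < m \<Longrightarrow> inp ! i = w i"
    and u: "\<And>j. j < n \<Longrightarrow> inp ! (m + j) = u j"
    and f: "\<And>i. i < m \<Longrightarrow> inp ! (m + n + i) = f i"
    and lam: "inp ! (2 * m + n) = lam"
    and nz: "\<And>j. j < n \<Longrightarrow> 1 + lam * u j \<noteq> 0"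
    and sub1: "sub 1 (map (\<lambda>i. w i * f i) [0..<m]) = Some (map a [0..<n])"
    and sub0: "sub 0 (map (\<lambda>j. a j / (1 + lam * u j)) [0..<n]) = Some (map z [0..<m])"
  shows "triple sub inp (\<lambda>_. True) (fit_prog m n) (fitted m n z f w (\<lambda>j. 1 + lam * u j))"
proof -
  define A where "A k s \<longleftrightarrow> s 0 = lam \<and> s 1 = 1 \<and>
     (\<forall>i<k. s (7 + m + i) = f i \<and> s (7 + 2 * m + i) = w i \<and> s (7 + 3 * m + i) = w i * f i)" for k and s :: memory
  \<comment> \<open>After \<open>k\<close> rounds of the second loop the first \<open>k\<close> coefficients have been divided in place.\<close>
  define B where "B k s \<longleftrightarrow> s 0 = lam \<and> s 1 = 1 \<and>
     (\<forall>i<m. s (7 + m + i) = f i \<and> s (7 + 2 * m + i) = w i) \<and>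
     (\<forall>j<n. s (7 + 4 * m + n + j) = (if j < k then a j / (1 + lam * u j) else a j)) \<and>
     (\<forall>j<k. s (7 + 4 * m + j) = 1 + lam * u j)" for k and s :: memory
  have init: "triple sub inp (\<lambda>_. True) [Input 0 (2 * m + n), Const 1 1] (A 0)"
    using lam len by (simp add: triple_def A_def)
  have "triple sub inp (A i) [Input (7 + 2 * m + i) i, Input (7 + m + i) (m + n + i),
         Mul (7 + 3 * m + i) (7 + 2 * m + i) (7 + m + i)] (A (Suc i))" if "i < m" for i
    using that w[OF that] f[OF that] len by (auto simp: triple_def A_def less_Suc_eq)
  then have weigh: "triple sub inp (A 0) (for_loop m (\<lambda>i. [Input (7 + 2 * m + i) i, Input (7 + m + i) (m + n + i),
         Mul (7 + 3 * m + i) (7 + 2 * m + i) (7 + m + i)])) (A m)"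
    by (rule triple_for_loop)
  have analyse: "triple sub inp (A m) [Call 1 (7 + 3 * m) m (7 + 4 * m + n)] (B 0)"
    unfolding triple_def
  proof (intro allI impI)
    fix s out assume s: "A m s"
    then have "map s [7 + 3 * m..<7 + 3 * m + m] = map (\<lambda>i. w i * f i) [0..<m]"
      by (intro nth_equalityI) (auto simp: A_def)
    with s show "\<exists>s'. run sub inp [Call 1 (7 + 3 * m) m (7 + 4 * m + n)] (s, out) = Some (s', out) \<and> B 0 s'"
      using sub1 by (auto simp: A_def B_def store_def)
  qed
  have "triple sub inp (B j) [Input (7 + 4 * m + j) (m + j), Mul (7 + 4 * m + j) 0 (7 + 4 * m + j),
         Add (7 + 4 * m + j) 1 (7 + 4 * m + j),
         Div (7 + 4 * m + n + j) (7 + 4 * m + n + j) (7 + 4 * m + j)] (B (Suc j))" if "j < n" for j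
    using that u[OF that] nz[OF that] len by (auto simp: triple_def B_def less_Suc_eq)
  then have filter: "triple sub inp (B 0) (for_loop n (\<lambda>j. [Input (7 + 4 * m + j) (m + j),
         Mul (7 + 4 * m + j) 0 (7 + 4 * m + j), Add (7 + 4 * m + j) 1 (7 + 4 * m + j),
         Div (7 + 4 * m + n + j) (7 + 4 * m + n + j) (7 + 4 * m + j)])) (B n)"
    by (rule triple_for_loop)
  have synthesise: "triple sub inp (B n) [Call 0 (7 + 4 * m + n) n 7] (fitted m n z f w (\<lambda>j. 1 + lam * u j))"
    unfolding triple_def
  proof (intro allI impI)
    fix s out assume s: "B n s"
    then have "map s [7 + 4 * m + n..<7 + 4 * m + n + n] = map (\<lambda>j. a j / (1 + lam * u j)) [0..<n]"
      by (intro nth_equalityI) (auto simp: B_def)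
    with s show "\<exists>s'. run sub inp [Call 0 (7 + 4 * m + n) n 7] (s, out) = Some (s', out)
        \<and> fitted m n z f w (\<lambda>j. 1 + lam * u j) s'"
      using sub0 by (auto simp: B_def fitted_def store_def)
  qed
  show ?thesis
    unfolding fit_prog_def
    by (rule triple_append[OF init triple_append[OF weigh triple_append[OF analyse
      triple_append[OF filter synthesise]]]])
qed

text \<open>Register 2 accumulates the sum \<open>\<Sum>\<^sub>j 1 / (1 + \<lambda> u\<^sub>j)\<close> that is common to all diagonal entries, and
  register 4 the sum of the diagonal entries.\<close>

definition leverage_prog :: "nat \<Rightarrow> nat \<Rightarrow> prog" where
  "leverage_prog m n =
     [Const 2 0]
     @ for_loop n (\<lambda>j. [Div 3 1 (7 + 4 * m + j), Add 2 2 3])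
     @ [Const 4 0]
     @ for_loop m (\<lambda>i. [Mul (7 + 2 * m + i) (7 + 2 * m + i) 2, Add 4 4 (7 + 2 * m + i)])
     @ [Const 3 (of_nat m), Div 5 4 3]"

text \<open>The memory between the second and the third phase: predictions \<open>z\<close>, data \<open>f\<close>, diagonal entries \<open>g\<close>
  and their mean \<open>h\<close>.\<close>

definition scorable :: "nat \<Rightarrow> (nat \<Rightarrow> complex) \<Rightarrow> (nat \<Rightarrow> complex) \<Rightarrow> (nat \<Rightarrow> complex) \<Rightarrow> complex \<Rightarrow> memory \<Rightarrow> bool" where
  "scorable m z f g h s \<longleftrightarrow> s 5 = h \<and>
     (\<forall>i<m. s (7 + i) = z i \<and> s (7 + m + i) = f i \<and> s (7 + 2 * m + i) = g i)"

lemma triple_leverage_prog: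
  fixes w :: "nat \<Rightarrow> complex"
  assumes m: "m > 0" and nz: "\<And>j. j < n \<Longrightarrow> e j \<noteq> 0"
    and g: "\<And>i. i < m \<Longrightarrow> g i = w i * (\<Sum>j<n. 1 / e j)"
  shows "triple sub inp (fitted m n z f w e) (leverage_prog m n) (scorable m z f g ((\<Sum>i<m. g i) / of_nat m))"
proof -
  define A where "A k s \<longleftrightarrow> fitted m n z f w e s \<and> s 2 = (\<Sum>j<k. 1 / e j)" for k s
  define B where "B k s \<longleftrightarrow> s 2 = (\<Sum>j<n. 1 / e j) \<and> s 4 = (\<Sum>i<k. g i) \<and>
     (\<forall>i<m. s (7 + i) = z i \<and> s (7 + m + i) = f i \<and> s (7 + 2 * m + i) = (if i < k then g i else w i))"
    for k and s :: memory
  have init: "triple sub inp (fitted m n z f w e) [Const 2 0] (A 0)"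
    by (simp add: triple_def A_def fitted_def)
  have "triple sub inp (A j) [Div 3 1 (7 + 4 * m + j), Add 2 2 3] (A (Suc j))" if "j < n" for j
    using that nz[OF that] by (auto simp: triple_def A_def fitted_def)
  then have trace: "triple sub inp (A 0) (for_loop n (\<lambda>j. [Div 3 1 (7 + 4 * m + j), Add 2 2 3])) (A n)"
    by (rule triple_for_loop)
  have reset: "triple sub inp (A n) [Const 4 0] (B 0)"
    by (simp add: triple_def A_def B_def fitted_def)
  have "triple sub inp (B i) [Mul (7 + 2 * m + i) (7 + 2 * m + i) 2, Add 4 4 (7 + 2 * m + i)] (B (Suc i))"
    if "i < m" for i
    using that g[OF that] by (auto simp: triple_def B_def less_Suc_eq)
  then have scale: "triple sub inp (B 0) (for_loop m (\<lambda>i. [Mul (7 + 2 * m + i) (7 + 2 * m + i) 2,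
      Add 4 4 (7 + 2 * m + i)])) (B m)"
    by (rule triple_for_loop)
  have mean: "triple sub inp (B m) [Const 3 (of_nat m), Div 5 4 3] (scorable m z f g ((\<Sum>i<m. g i) / of_nat m))"
    using m by (simp add: triple_def B_def scorable_def)
  show ?thesis
    unfolding leverage_prog_def
    by (rule triple_append[OF init triple_append[OF trace triple_append[OF reset triple_append[OF scale mean]]]])
qed

text \<open>The squared modulus is computed as \<open>z * cnj z\<close>.  Registers 2 and 3 accumulate the ordinary and the
  generalized score; register 4 holds the common denominator of the latter.  The constant 1 is
  written again, so that the phase makes no assumption on the registers below 7 other than 5.\<close>

definition score_prog :: "nat \<Rightarrow> prog" where
  "score_prog m =
     [Const 1 1, Const 2 0, Const 3 0, Sub 4 1 5, Mul 4 4 4]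
     @ for_loop m (\<lambda>i. [Sub 0 (7 + i) (7 + m + i), Conj 6 0, Mul 0 0 6,
         Sub 6 1 (7 + 2 * m + i), Mul 6 6 6, Div 6 0 6, Add 2 2 6, Div 0 0 4, Add 3 3 0])
     @ [Output 2, Output 3]"

lemma score_prog_evaluates_scores: "evaluates_scores m 7 (7 + m) (7 + 2 * m) 5 (score_prog m)"
  unfolding evaluates_scores_def
proof (intro allI impI)
  fix sub inp s out
  assume g: "\<forall>i<m. s (7 + 2 * m + i) \<noteq> (1 :: complex)" and h: "s 5 \<noteq> 1"
  let ?r = "\<lambda>i. complex_of_real ((cmod (s (7 + i) - s (7 + m + i)))\<^sup>2)"
  define A where "A k s' \<longleftrightarrow> (\<forall>r\<ge>7. s' r = s r) \<and> s' 1 = 1 \<and> s' 4 = (1 - s 5)\<^sup>2 \<and>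
      s' 2 = (\<Sum>i<k. ?r i / (1 - s (7 + 2 * m + i))\<^sup>2) \<and> s' 3 = (\<Sum>i<k. ?r i / (1 - s 5)\<^sup>2)"
    for k and s' :: memory
  have init: "triple sub inp (\<lambda>s'. s' = s) [Const 1 1, Const 2 0, Const 3 0, Sub 4 1 5, Mul 4 4 4] (A 0)"
    by (simp add: triple_def A_def power2_eq_square)
  have sq: "z * cnj z = complex_of_real ((cmod z)\<^sup>2)" for z
    by (metis complex_norm_square)
  have "triple sub inp (A i) [Sub 0 (7 + i) (7 + m + i), Conj 6 0, Mul 0 0 6,
         Sub 6 1 (7 + 2 * m + i), Mul 6 6 6, Div 6 0 6, Add 2 2 6, Div 0 0 4, Add 3 3 0] (A (Suc i))"
    if "i < m" for i
    using that g h by (simp add: triple_def A_def sq power2_eq_square del: complex_cnj_diff)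
  then have "triple sub inp (A 0) (for_loop m (\<lambda>i. [Sub 0 (7 + i) (7 + m + i), Conj 6 0, Mul 0 0 6,
         Sub 6 1 (7 + 2 * m + i), Mul 6 6 6, Div 6 0 6, Add 2 2 6, Div 0 0 4, Add 3 3 0])) (A m)"
    by (rule triple_for_loop)
  from triple_append[OF init this] obtain s' where
    "run sub inp ([Const 1 1, Const 2 0, Const 3 0, Sub 4 1 5, Mul 4 4 4] @
       for_loop m (\<lambda>i. [Sub 0 (7 + i) (7 + m + i), Conj 6 0, Mul 0 0 6,
         Sub 6 1 (7 + 2 * m + i), Mul 6 6 6, Div 6 0 6, Add 2 2 6, Div 0 0 4, Add 3 3 0])) (s, out) = Some (s', out)"
    "A m s'"
    unfolding triple_def by blast
  then show "\<exists>s'. run sub inp (score_prog m) (s, out) = Some (s', out @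
     [\<Sum>i<m. ?r i / (1 - s (7 + 2 * m + i))\<^sup>2, \<Sum>i<m. ?r i / (1 - s 5)\<^sup>2])"
    unfolding score_prog_def append_assoc[symmetric] by (subst run_append) (simp add: A_def)
qed

lemma cost_progs:
  "cost [p, q] (fit_prog m n @ leverage_prog m n @ score_prog m)
     = cost [] p + cost [] q + 14 * m + 6 * n + 6"
proof -
  have "cost [] r = cost_with (\<lambda>_. 0) r" for r
    by (simp add: cost_def)
  then show ?thesis
    unfolding cost_def fit_prog_def leverage_prog_def score_prog_def
    by (simp add: cost_with_simps cost_with_for_loop[where b = 3] cost_with_for_loop[where b = 4] cost_with_for_loop[where b = 2] cost_with_for_loop[where b = 9])
qed

section \<open>Cross-validation for exact quadrature rules\<close>

locale quadrature_fit =
  fixes d :: nat and xs :: "node list" and ns :: "freq list"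
    and wt :: "node \<Rightarrow> real" and fwt :: "freq \<Rightarrow> real" and reg :: real
  assumes distinct_nodes: "distinct xs"
    and distinct_freqs: "distinct ns" "set ns \<subseteq> multi_indices d"
    and wt_pos: "\<forall>x\<in>set xs. wt x > 0"
    and fwt_pos: "\<forall>k\<in>set ns. fwt k > 0"
    and exact: "\<forall>k\<in>difference_set d (set ns). exact_for d (set xs) wt (expo d k)"
    and reg_pos: "reg > 0"

sublocale quadrature_fit \<subseteq> orthonormal_fit "fourier_mat d xs ns" "length xs" "length ns"
    "\<lambda>i. wt (xs ! i)" "\<lambda>j. fwt (ns ! j)" reg
proof unfold_locales
  fix i j l
  show "0 \<le> wt (xs ! i)" if "i < length xs"
    using wt_pos nth_mem[OF that] by (simp add: less_imp_le)
  show "0 < fwt (ns ! j)" if "j < length ns"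
    using fwt_pos nth_mem[OF that] by simp
  show "cmod (fourier_mat d xs ns $$ (i, j)) = 1" if "i < length xs" "j < length ns"
    using that by (simp add: fourier_mat_def norm_expo)
  show "j < length ns \<Longrightarrow> l < length ns \<Longrightarrow>
      (\<Sum>i<length xs. cnj (fourier_mat d xs ns $$ (i, j)) * of_real (wt (xs ! i)) * fourier_mat d xs ns $$ (i, l))
        = (if j = l then 1 else 0)"
    by (rule fourier_gram[OF distinct_nodes distinct_freqs exact])
qed (simp_all add: fourier_mat_carrier reg_pos)

context quadrature_fit
begin

lemma hat_mat_eq: "hat_mat d xs ns wt fwt reg = hat"
  by (simp add: hat_mat_def hat_def solve_def weight_mat_def)

lemma hat_mean_eq:
  "hat_mean d xs ns wt fwt reg = (\<Sum>i<length xs. hat $$ (i, i)) / of_nat (length xs)"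
  by (simp add: hat_mean_def hat_mat_eq)

lemma hat_diag_neq_1: "i < length xs \<Longrightarrow> hat $$ (i, i) \<noteq> 1"
  using hat_diag_less_1[of i] unfolding hat_diag by (metis less_irrefl of_real_eq_1_iff)

lemma hat_mean_neq_1:
  assumes "xs \<noteq> []"
  shows "hat_mean d xs ns wt fwt reg \<noteq> 1"
proof -
  let ?r = "\<lambda>i. wt (xs ! i) * (\<Sum>j<length ns. 1 / (1 + reg * fwt (ns ! j)))"
  have "(\<Sum>i<length xs. ?r i) < (\<Sum>i<length xs. 1)"
    using assms by (intro sum_strict_mono hat_diag_less_1) auto
  then have "(\<Sum>i<length xs. ?r i) \<noteq> real (length xs)"
    by simp
  moreover have "(\<Sum>i<length xs. hat $$ (i, i)) = complex_of_real (\<Sum>i<length xs. ?r i)"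
    unfolding of_real_sum by (rule sum.cong) (simp_all only: hat_diag lessThan_iff)
  ultimately have "(\<Sum>i<length xs. hat $$ (i, i)) \<noteq> of_real (real (length xs))"
    by (simp only: of_real_eq_iff not_False_eq_True)
  then show ?thesis
    unfolding hat_mean_eq using assms by (simp add: divide_eq_eq)
qed

lemma leave_one_out_eq:
  assumes i: "i < length xs"
  shows "leave_one_out d xs ns wt fwt f reg i =
    ridge_fit.solve (delete_row (fourier_mat d xs ns) i) (length xs - 1) (length ns)
      (\<lambda>k. wt (xs ! insert_index i k)) (\<lambda>j. fwt (ns ! j)) reg *\<^sub>v delete_entry f i"
proof -
  have "mat_delete (weight_mat wt xs) i i
      = mat_diag (length xs - 1) (\<lambda>k. of_real (wt (xs ! insert_index i k)))"
    using i by (intro eq_matI) (auto simp: mat_delete_def weight_mat_def mat_diag_def insert_index_def)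
  then show ?thesis
    unfolding leave_one_out_def ridge_fit.solve_def[OF without_node[OF i]] by (simp add: weight_mat_def)
qed

text \<open>The factor \<open>1 - h\<^sub>x\<^sub>x\<close> of \<open>leave_one_out_residual\<close> is a nonzero real number, so the square of its
  modulus is its square.\<close>

lemma ocv_score_eq:
  assumes f: "f \<in> carrier_vec (length xs)"
  shows "ocv_score d xs ns wt fwt f reg
    = (\<Sum>i<length xs. of_real ((cmod ((hat *\<^sub>v f) $ i - f $ i))\<^sup>2) / (1 - hat $$ (i, i))\<^sup>2)"
  unfolding ocv_score_def
proof (intro sum.cong refl)
  fix i assume "i \<in> {..<length xs}"
  then have i: "i < length xs" by simp
  define v where "v = leave_one_out d xs ns wt fwt f reg i"
  define r where "r = wt (xs ! i) * (\<Sum>j<length ns. 1 / (1 + reg * fwt (ns ! j)))"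
  have hat_r: "hat $$ (i, i) = of_real r"
    unfolding r_def by (rule hat_diag[OF i])
  have "(1 - hat $$ (i, i)) * ((fourier_mat d xs ns *\<^sub>v v) $ i - f $ i) = (hat *\<^sub>v f) $ i - f $ i"
    unfolding v_def leave_one_out_eq[OF i] by (rule leave_one_out_residual[OF i f])
  then have "(hat *\<^sub>v f) $ i - f $ i = of_real (1 - r) * ((fourier_mat d xs ns *\<^sub>v v) $ i - f $ i)"
    by (simp only: hat_r of_real_diff of_real_1)
  then have "(cmod ((hat *\<^sub>v f) $ i - f $ i))\<^sup>2
      = (1 - r)\<^sup>2 * (cmod ((fourier_mat d xs ns *\<^sub>v v) $ i - f $ i))\<^sup>2"
    by (simp only: norm_mult norm_of_real power_mult_distrib power2_abs)
  moreover have "r \<noteq> 1"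
    using hat_diag_neq_1[OF i] by (simp add: hat_r)
  ultimately have "(cmod ((fourier_mat d xs ns *\<^sub>v v) $ i - f $ i))\<^sup>2
      = (cmod ((hat *\<^sub>v f) $ i - f $ i))\<^sup>2 / (1 - r)\<^sup>2"
    by (simp del: index_mult_mat_vec)
  then show "complex_of_real ((cmod ((fourier_mat d xs ns *\<^sub>v leave_one_out d xs ns wt fwt f reg i) $ i - f $ i))\<^sup>2)
      = of_real ((cmod ((hat *\<^sub>v f) $ i - f $ i))\<^sup>2) / (1 - hat $$ (i, i))\<^sup>2"
    unfolding v_def[symmetric] hat_r by (simp only: of_real_divide of_real_power of_real_diff of_real_1)
qed

lemma gcv_score_eq:
  assumes f: "f \<in> carrier_vec (length xs)"
  shows "gcv_score d xs ns wt fwt f reg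
    = (\<Sum>i<length xs. of_real ((cmod ((hat *\<^sub>v f) $ i - f $ i))\<^sup>2) / (1 - hat_mean d xs ns wt fwt reg)\<^sup>2)"
  unfolding gcv_score_def hat_mat_eq
  using f hat_carrier by (intro sum.cong refl) (simp del: index_mult_mat_vec)

text \<open>By \<open>solve_mult_vec\<close> the predictions \<open>H f\<close> arise from \<open>F\<^sup>H W f\<close> by an entrywise division followed by
  a multiplication with \<open>F\<close>, which is what the first phase does.\<close>

lemma triple_fit_prog_hat:
  assumes f: "f \<in> carrier_vec (length xs)"
    and pF: "multiplies_with pF (fourier_mat d xs ns)"
    and pFH: "multiplies_with pFH (mat_adjoint (fourier_mat d xs ns))"
  shows "triple (subs_of [pF, pFH]) (score_input xs ns wt fwt f reg) (\<lambda>_. True) (fit_prog (length xs) (length ns))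
    (fitted (length xs) (length ns) (\<lambda>i. (hat *\<^sub>v f) $ i) (\<lambda>i. f $ i) (\<lambda>i. of_real (wt (xs ! i)))
       (\<lambda>j. 1 + of_real reg * of_real (fwt (ns ! j))))"
proof -
  let ?F = "fourier_mat d xs ns" and ?m = "length xs" and ?n = "length ns"
  let ?wf = "Matrix.vec ?m (\<lambda>i. of_real (wt (xs ! i)) * f $ i)"
  define a where "a = mat_adjoint ?F *\<^sub>v ?wf"
  have a: "a \<in> carrier_vec ?n"
    unfolding a_def using mat_adjoint_carrier[OF F] by (rule mult_mat_vec_carrier) simp
  have "a $ j = (\<Sum>i<?m. cnj (?F $$ (i, j)) * of_real (wt (xs ! i)) * f $ i)" if "j < ?n" for j
    unfolding a_def using that mat_adjoint_carrier[OF F]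
    by (simp add: scalar_prod_def mat_adjoint_index[OF F] atLeast0LessThan mult_ac)
  then have "solve *\<^sub>v f = Matrix.vec ?n (\<lambda>j. a $ j / (1 + of_real reg * of_real (fwt (ns ! j))))"
    unfolding solve_mult_vec[OF f] by (intro eq_vecI) simp_all
  then have hat_f: "hat *\<^sub>v f = ?F *\<^sub>v Matrix.vec ?n (\<lambda>j. a $ j / (1 + of_real reg * of_real (fwt (ns ! j))))"
    by (simp only: hat_mult_vec[OF f])
  have hat_f_carrier: "hat *\<^sub>v f \<in> carrier_vec ?m"
    using hat_carrier f by (rule mult_mat_vec_carrier)
  have as_map: "list_of_vec v = map (\<lambda>i. v $ i) [0..<k]" if "v \<in> carrier_vec k" for k and v :: "complex Matrix.vec"
    using that by (simp add: list_of_vec_map)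
  show ?thesis
  proof (rule triple_fit_prog)
    have "eval_prog no_subs pFH (list_of_vec ?wf) = Some (list_of_vec a)"
      unfolding a_def by (rule eval_multiplies_with[OF pFH mat_adjoint_carrier[OF F]]) simp
    then show "subs_of [pF, pFH] 1 (map (\<lambda>i. of_real (wt (xs ! i)) * f $ i) [0..<?m]) = Some (map (\<lambda>i. a $ i) [0..<?n])"
      by (simp add: subs_of_def as_map[OF a])
    have "eval_prog no_subs pF (list_of_vec (Matrix.vec ?n (\<lambda>j. a $ j / (1 + of_real reg * of_real (fwt (ns ! j))))))
        = Some (list_of_vec (hat *\<^sub>v f))"
      unfolding hat_f by (rule eval_multiplies_with[OF pF F]) simp
    then show "subs_of [pF, pFH] 0 (map (\<lambda>j. a $ j / (1 + of_real reg * of_real (fwt (ns ! j)))) [0..<?n])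
        = Some (map (\<lambda>i. (hat *\<^sub>v f) $ i) [0..<?m])"
      by (simp add: subs_of_def as_map[OF hat_f_carrier])
  qed (use f denominator_nonzero in \<open>simp_all add: score_input_def nth_append list_of_vec_index\<close>)
qed

lemma triple_leverage_prog_hat:
  assumes "xs \<noteq> []"
  shows "triple sub inp
    (fitted (length xs) (length ns) z f (\<lambda>i. of_real (wt (xs ! i))) (\<lambda>j. 1 + of_real reg * of_real (fwt (ns ! j))))
    (leverage_prog (length xs) (length ns))
    (scorable (length xs) z f (\<lambda>i. hat $$ (i, i)) (hat_mean d xs ns wt fwt reg))"
  unfolding hat_mean_eq
proof (rule triple_leverage_prog)
  show "hat $$ (i, i) = of_real (wt (xs ! i)) * (\<Sum>j<length ns. 1 / (1 + of_real reg * of_real (fwt (ns ! j))))"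
    if "i < length xs" for i
    by (simp add: hat_diag[OF that])
qed (use assms denominator_nonzero in auto)

lemma cross_validation_programs:
  assumes xs: "xs \<noteq> []" and f: "f \<in> carrier_vec (length xs)"
    and pF: "multiplies_with pF (fourier_mat d xs ns)"
    and pFH: "multiplies_with pFH (mat_adjoint (fourier_mat d xs ns))"
  defines "m \<equiv> length xs" and "n \<equiv> length ns"
    and "subs \<equiv> subs_of [pF, pFH]" and "inp \<equiv> score_input xs ns wt fwt f reg"
    and "hm \<equiv> hat_mean d xs ns wt fwt reg"
  obtains s1 s2 s3 where
    "run subs inp (fit_prog m n) init_state = Some (s1, [])"
    "\<forall>i<m. s1 (7 + i) = (hat *\<^sub>v f) $ i"
    "run subs inp (leverage_prog m n) (s1, []) = Some (s2, [])"
    "\<forall>i<m. s2 (7 + i) = (hat *\<^sub>v f) $ i"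
    "\<forall>i<m. s2 (7 + m + i) = f $ i"
    "\<forall>i<m. s2 (7 + 2 * m + i) = hat $$ (i, i)"
    "s2 5 = hm"
    "run subs inp (score_prog m) (s2, [])
       = Some (s3, [ocv_score d xs ns wt fwt f reg, gcv_score d xs ns wt fwt f reg])"
proof -
  obtain s1 where s1: "run subs inp (fit_prog m n) init_state = Some (s1, [])"
    and fitted: "fitted m n (\<lambda>i. (hat *\<^sub>v f) $ i) (\<lambda>i. f $ i) (\<lambda>i. of_real (wt (xs ! i)))
      (\<lambda>j. 1 + of_real reg * of_real (fwt (ns ! j))) s1"
    using triple_fit_prog_hat[OF f pF pFH]
    unfolding triple_def init_state_def m_def n_def subs_def inp_def by blast
  obtain s2 where s2: "run subs inp (leverage_prog m n) (s1, []) = Some (s2, [])"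
    and scorable: "scorable m (\<lambda>i. (hat *\<^sub>v f) $ i) (\<lambda>i. f $ i) (\<lambda>i. hat $$ (i, i)) hm s2"
    using triple_leverage_prog_hat[OF xs, of subs inp] fitted
    unfolding triple_def m_def n_def hm_def by blast
  have t1: "\<forall>i<m. s1 (7 + i) = (hat *\<^sub>v f) $ i"
    using fitted by (simp add: fitted_def del: index_mult_mat_vec)
  have t2: "\<forall>i<m. s2 (7 + i) = (hat *\<^sub>v f) $ i" and y2: "\<forall>i<m. s2 (7 + m + i) = f $ i"
    and g2: "\<forall>i<m. s2 (7 + 2 * m + i) = hat $$ (i, i)" and h2: "s2 5 = hm"
    using scorable by (simp_all add: scorable_def del: index_mult_mat_vec)
  have "\<forall>i<m. s2 (7 + 2 * m + i) \<noteq> 1"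
    using g2 hat_diag_neq_1 by (simp add: m_def)
  moreover have "s2 5 \<noteq> 1"
    using h2 hat_mean_neq_1[OF xs] by (simp add: hm_def)
  ultimately obtain s3 where s3: "run subs inp (score_prog m) (s2, []) = Some (s3, [] @
       [\<Sum>i<m. of_real ((cmod (s2 (7 + i) - s2 (7 + m + i)))\<^sup>2) / (1 - s2 (7 + 2 * m + i))\<^sup>2,
        \<Sum>i<m. of_real ((cmod (s2 (7 + i) - s2 (7 + m + i)))\<^sup>2) / (1 - s2 5)\<^sup>2])"
    using score_prog_evaluates_scores[of m, unfolded evaluates_scores_def, rule_format, of s2 subs inp "[]"]
    by blast
  have ocv: "(\<Sum>i<m. of_real ((cmod (s2 (7 + i) - s2 (7 + m + i)))\<^sup>2) / (1 - s2 (7 + 2 * m + i))\<^sup>2)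
      = ocv_score d xs ns wt fwt f reg"
    unfolding ocv_score_eq[OF f]
    by (rule sum.cong[symmetric]) (simp add: m_def, simp add: t2 y2 g2 del: index_mult_mat_vec)
  have gcv: "(\<Sum>i<m. of_real ((cmod (s2 (7 + i) - s2 (7 + m + i)))\<^sup>2) / (1 - s2 5)\<^sup>2)
      = gcv_score d xs ns wt fwt f reg"
    unfolding gcv_score_eq[OF f] h2 hm_def
    by (rule sum.cong[symmetric]) (simp add: m_def, simp add: t2 y2 del: index_mult_mat_vec)
  show thesis
    using s3 unfolding ocv gcv append_Nil by (rule that[OF s1 t1 s2 t2 y2 g2 h2])
qed

end

theorem corollary3p3:
  shows "\<exists>K::nat. \<forall>m>0. \<forall>n. \<exists>p1 p2 p3 t y g h.
    evaluates_scores m t y g h p3 \<and>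
    (\<forall>(d::nat) (xs :: node list) (ns :: freq list) (w :: node \<Rightarrow> real) (what :: freq \<Rightarrow> real)
        (f :: complex Matrix.vec) (lam :: real) (pF :: prog) (pFH :: prog) (C :: nat).
      length xs = m \<longrightarrow> distinct xs \<longrightarrow> set xs \<subseteq> torus d \<longrightarrow>
      length ns = n \<longrightarrow> distinct ns \<longrightarrow> set ns \<subseteq> multi_indices d \<longrightarrow>
      (\<forall>x\<in>set xs. w x > 0) \<longrightarrow> (\<forall>k\<in>set ns. what k > 0) \<longrightarrow>
      (\<forall>k\<in>difference_set d (set ns). exact_for d (set xs) w (expo d k)) \<longrightarrow>
      lam > 0 \<longrightarrow> f \<in> carrier_vec m \<longrightarrow>
      multiplies_with pF (fourier_mat d xs ns) \<longrightarrow> cost [] pF \<le> C \<longrightarrow>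
      multiplies_with pFH (mat_adjoint (fourier_mat d xs ns)) \<longrightarrow> cost [] pFH \<le> C \<longrightarrow>
      (let subs = subs_of [pF, pFH];
           inp = score_input xs ns w what f lam;
           H = hat_mat d xs ns w what lam;
           hm = hat_mean d xs ns w what lam;
           P = ocv_score d xs ns w what f lam;
           V = gcv_score d xs ns w what f lam
       in (\<forall>i<m. H $$ (i, i) \<noteq> 1) \<and> hm \<noteq> 1 \<and>
          (\<exists>s1. run subs inp p1 init_state = Some (s1, []) \<and>
             (\<forall>i<m. s1 (t + i) = (H *\<^sub>v f) $ i) \<and>
           (\<exists>s2. run subs inp p2 (s1, []) = Some (s2, []) \<and>
             (\<forall>i<m. s2 (t + i) = (H *\<^sub>v f) $ i) \<and>
             (\<forall>i<m. s2 (y + i) = f $ i) \<and>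
             (\<forall>i<m. s2 (g + i) = H $$ (i, i)) \<and> s2 h = hm)) \<and>
          P = (\<Sum>i<m. of_real ((cmod ((H *\<^sub>v f) $ i - f $ i))\<^sup>2) / (1 - H $$ (i, i))\<^sup>2) \<and>
          V = (\<Sum>i<m. of_real ((cmod ((H *\<^sub>v f) $ i - f $ i))\<^sup>2) / (1 - hm)\<^sup>2) \<and>
          eval_prog subs (p1 @ p2 @ p3) inp = Some [P, V] \<and>
          cost [pF, pFH] (p1 @ p2 @ p3) \<le> K * C))"
proof -
  let "\<exists>K. \<forall>m>0. \<forall>n. \<exists>p1 p2 p3 t y g h. ?good K m n p1 p2 p3 t y g h" = ?thesis
  have programs: "?good 28 m n (fit_prog m n) (leverage_prog m n) (score_prog m) 7 (7 + m) (7 + 2 * m) 5"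
    if m: "m > 0" for m n
  proof (rule conjI[OF score_prog_evaluates_scores], intro allI impI, goal_cases)
    case (1 d xs ns w what f lam pF pFH C)
    then interpret quadrature_fit d xs ns w what lam
      by unfold_locales
    have len: "m = length xs" "n = length ns" and xs: "xs \<noteq> []" and f: "f \<in> carrier_vec (length xs)"
      using 1 m by auto
    have pF: "multiplies_with pF (fourier_mat d xs ns)" "cost [] pF \<le> C"
      and pFH: "multiplies_with pFH (mat_adjoint (fourier_mat d xs ns))" "cost [] pFH \<le> C"
      using 1 by blast+
    obtain s1 s2 s3 where runs:
      "run (subs_of [pF, pFH]) (score_input xs ns w what f lam) (fit_prog m n) init_state = Some (s1, [])"
      "\<forall>i<m. s1 (7 + i) = (hat *\<^sub>v f) $ i"
      "run (subs_of [pF, pFH]) (score_input xs ns w what f lam) (leverage_prog m n) (s1, []) = Some (s2, [])"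
      "\<forall>i<m. s2 (7 + i) = (hat *\<^sub>v f) $ i"
      "\<forall>i<m. s2 (7 + m + i) = f $ i"
      "\<forall>i<m. s2 (7 + 2 * m + i) = hat $$ (i, i)"
      "s2 5 = hat_mean d xs ns w what lam"
      "run (subs_of [pF, pFH]) (score_input xs ns w what f lam) (score_prog m) (s2, [])
         = Some (s3, [ocv_score d xs ns w what f lam, gcv_score d xs ns w what f lam])"
      unfolding len using xs f pF(1) pFH(1) by (rule cross_validation_programs)
    have diag: "\<forall>i<m. hat $$ (i, i) \<noteq> 1"
      using hat_diag_neq_1 by (simp add: len)
    have ocv: "ocv_score d xs ns w what f lam
        = (\<Sum>i<m. of_real ((cmod ((hat *\<^sub>v f) $ i - f $ i))\<^sup>2) / (1 - hat $$ (i, i))\<^sup>2)"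
      unfolding len by (rule ocv_score_eq[OF f])
    have gcv: "gcv_score d xs ns w what f lam
        = (\<Sum>i<m. of_real ((cmod ((hat *\<^sub>v f) $ i - f $ i))\<^sup>2) / (1 - hat_mean d xs ns w what lam)\<^sup>2)"
      unfolding len by (rule gcv_score_eq[OF f])
    have eval: "eval_prog (subs_of [pF, pFH]) (fit_prog m n @ leverage_prog m n @ score_prog m)
        (score_input xs ns w what f lam) = Some [ocv_score d xs ns w what f lam, gcv_score d xs ns w what f lam]"
      by (simp add: eval_prog_def run_append runs(1,3,8))
    \<comment> \<open>With \<open>1 \<le> m\<close> the constant overhead is absorbed as well: \<open>2 C + 14 m + 6 n + 6 \<le> 28 C\<close>.\<close>
    have "m \<le> C" "n \<le> C"
      using cost_ge_output_dim[OF pF(1)] cost_ge_output_dim[OF pFH(1)] pF(2) pFH(2)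
        carrier_matD[OF F] carrier_matD[OF mat_adjoint_carrier[OF F]] by (simp_all add: len)
    then have cost: "cost [pF, pFH] (fit_prog m n @ leverage_prog m n @ score_prog m) \<le> 28 * C"
      unfolding cost_progs using m pF(2) pFH(2) by linarith
    show ?case
      unfolding Let_def hat_mat_eq
      using diag hat_mean_neq_1[OF xs] runs(1-7) ocv gcv eval cost
      by - (intro conjI; (assumption | (rule exI[of _ s1], intro conjI;
          (assumption | (rule exI[of _ s2], intro conjI; assumption)))))
  qed
  show ?thesis
  proof (rule exI[of _ "28::nat"], intro allI impI)
    fix m n :: nat
    assume "m > 0"
    then show "\<exists>p1 p2 p3 t y g h. ?good 28 m n p1 p2 p3 t y g h"
      by (intro exI) (rule programs)
  qed
qed

end
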